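(* Define $m(n,d):=(2d)^{(n-1)(n!)2^{(n-2)n}}$ for all integers $n>2$, $d>1$; $m(n,1):=1$ for every $n\geq 1$; and, for $d>1$, $m(1,d):=d$ and $m(2,d):=4d^4$. Let $n,d\geq 1$. For any field $k$ and any proper ideal $I\subseteq k[x_1,\ldots,x_n]$ with generators of total degree at most $d$, if $I$ is maximal up to $m(n,d)$, then $I$ is a maximal ideal.
   Context: For a proper ideal $I\subseteq k[x_1,\ldots,x_n]$ and a natural number $b$, $I$ is called maximal up to $b$ if every $f\in k[x_1,\ldots,x_n]\setminus I$ of total degree at most $b$ has an inverse modulo $I$, i.e. there is some $g\in k[x_1,\ldots,x_n]$ (of any degree) with $fg-1\in I$. *)

theory Defs
  imports "HOL-Algebra.Ideal" "HOL-Library.Poly_Mapping"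
begin

text \<open>
  A polynomial is a finitely supported map from monomials to coefficients, and a monomial is a
  finitely supported map from variable indices to exponents. In this type there are infinitely
  many variables \<open>x\<^sub>0, x\<^sub>1, \<dots>\<close>, so \<open>k[x\<^sub>1,\<dots>,x\<^sub>n]\<close> is the subring of the polynomials in which
  only variables with index in \<open>{1..n}\<close> occur. Convolution is the multiplication that
  \<^theory>\<open>HOL-Library.Poly_Mapping\<close> provides.
\<close>

type_synonym 'k mpoly = "(nat \<Rightarrow>\<^sub>0 nat) \<Rightarrow>\<^sub>0 'k"

definition mpoly_ring :: "nat \<Rightarrow> 'k::field mpoly ring" where
  "mpoly_ring n =
     \<lparr>carrier = {p. \<forall>mon \<in> Poly_Mapping.keys p. Poly_Mapping.keys mon \<subseteq> {1..n}},
      mult = (*), one = 1, zero = 0, add = (+)\<rparr>"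

text \<open>The zero polynomial gets total degree \<open>0\<close>.\<close>

definition total_degree :: "'k::zero mpoly \<Rightarrow> nat" where
  "total_degree p =
     Max (insert 0 ((\<lambda>mon. \<Sum>i\<in>Poly_Mapping.keys mon. Poly_Mapping.lookup mon i)
                      ` Poly_Mapping.keys p))"

definition maximal_up_to :: "nat \<Rightarrow> nat \<Rightarrow> 'k::field mpoly set \<Rightarrow> bool" where
  "maximal_up_to n b I \<longleftrightarrow>
     (\<forall>f \<in> carrier (mpoly_ring n) - I. total_degree f \<le> b \<longrightarrow>
        (\<exists>g \<in> carrier (mpoly_ring n). f * g - 1 \<in> I))"

text \<open>Only the values at \<open>n, d \<ge> 1\<close> are meaningful.\<close>

definition max_bound :: "nat \<Rightarrow> nat \<Rightarrow> nat" where
  "max_bound n d =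
     (if d = 1 then 1
      else if n = 1 then d
      else if n = 2 then 4 * d ^ 4
      else (2 * d) ^ ((n - 1) * fact n * 2 ^ ((n - 2) * n)))"

lemma mpoly_ring_simps [simp]:
  "mult (mpoly_ring n) = (*)" "one (mpoly_ring n) = 1"
  "zero (mpoly_ring n) = 0" "add (mpoly_ring n) = (+)"
  by (simp_all add: mpoly_ring_def)

lemma mem_carrier_mpoly_ring:
  "p \<in> carrier (mpoly_ring n) \<longleftrightarrow>
     (\<forall>mon \<in> Poly_Mapping.keys p. Poly_Mapping.keys mon \<subseteq> {1..n})"
  by (simp add: mpoly_ring_def)

lemma mpoly_ring_closed:
  fixes p q :: "'k::field mpoly"
  shows "0 \<in> carrier (mpoly_ring n :: 'k mpoly ring)" "1 \<in> carrier (mpoly_ring n :: 'k mpoly ring)"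
    and "p \<in> carrier (mpoly_ring n) \<Longrightarrow> - p \<in> carrier (mpoly_ring n)"
    and "p \<in> carrier (mpoly_ring n) \<Longrightarrow> q \<in> carrier (mpoly_ring n) \<Longrightarrow> p + q \<in> carrier (mpoly_ring n)"
    and "p \<in> carrier (mpoly_ring n) \<Longrightarrow> q \<in> carrier (mpoly_ring n) \<Longrightarrow> p * q \<in> carrier (mpoly_ring n)"
proof -
  show "0 \<in> carrier (mpoly_ring n :: 'k mpoly ring)" "1 \<in> carrier (mpoly_ring n :: 'k mpoly ring)"
    by (simp_all add: mem_carrier_mpoly_ring)
  show "- p \<in> carrier (mpoly_ring n)" if "p \<in> carrier (mpoly_ring n)"
    using that by (simp add: mem_carrier_mpoly_ring in_keys_iff)
  show "p + q \<in> carrier (mpoly_ring n)" if "p \<in> carrier (mpoly_ring n)" "q \<in> carrier (mpoly_ring n)"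
    using that Poly_Mapping.keys_add[of p q] unfolding mem_carrier_mpoly_ring by blast
  show "p * q \<in> carrier (mpoly_ring n)"
    if pq: "p \<in> carrier (mpoly_ring n)" "q \<in> carrier (mpoly_ring n)"
    unfolding mem_carrier_mpoly_ring
  proof
    fix mon assume "mon \<in> Poly_Mapping.keys (p * q)"
    with keys_mult[of p q] obtain a b where
      ab: "mon = a + b" "a \<in> Poly_Mapping.keys p" "b \<in> Poly_Mapping.keys q" by blast
    with pq have "Poly_Mapping.keys a \<subseteq> {1..n}" "Poly_Mapping.keys b \<subseteq> {1..n}"
      unfolding mem_carrier_mpoly_ring by blast+
    then show "Poly_Mapping.keys mon \<subseteq> {1..n}"
      using Poly_Mapping.keys_add[of a b] ab(1) by blast
  qed
qed

lemma cring_mpoly_ring: "cring (mpoly_ring n :: 'k::field mpoly ring)"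
proof (rule cringI)
  let ?R = "mpoly_ring n :: 'k mpoly ring"
  show "abelian_group ?R"
  proof (rule abelian_groupI)
    fix x assume "x \<in> carrier ?R"
    then show "\<exists>y\<in>carrier ?R. y \<oplus>\<^bsub>?R\<^esub> x = \<zero>\<^bsub>?R\<^esub>"
      by (intro bexI[of _ "- x"]) (simp_all add: mpoly_ring_closed)
  qed (simp_all add: mpoly_ring_closed add_ac)
  show "comm_monoid ?R"
    by (rule comm_monoidI) (simp_all add: mpoly_ring_closed mult_ac)
  show "(x \<oplus>\<^bsub>?R\<^esub> y) \<otimes>\<^bsub>?R\<^esub> z = x \<otimes>\<^bsub>?R\<^esub> z \<oplus>\<^bsub>?R\<^esub> y \<otimes>\<^bsub>?R\<^esub> z" for x y z
    by (simp add: distrib_right)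
qed

end

theory Submission
  imports Defs "HOL-Algebra.Algebraic_Closure_Type"
begin

text \<open>
  Suppose that for every variable \<open>x\<close> some nonzero \<open>h(x) \<in> I\<close> has degree at most \<open>D\<close>. Then every
  polynomial is congruent modulo \<open>I\<close> to one of degree at most \<open>n (D - 1)\<close>, and if \<open>n (D - 1)\<close> is at
  most the given bound, every nonzero residue class is a unit.

  To find \<open>h\<close>, regard \<open>1 = \<Sum> h\<^sub>g g\<close> with bounded degree of the \<open>h\<^sub>g\<close> in the other variables as a linear
  system over \<open>k[x]\<close>. Either some \<open>h(x) \<noteq> 0\<close> is a bounded combination of the generators, or a vector
  \<open>w\<close> over \<open>k[x]\<close> of bounded degree annihilates the system and has entry \<open>w\<^sub>0 \<noteq> 0\<close> at the monomial
  \<open>1\<close>. In the second case take a root \<open>c\<close> of \<open>1 + x w\<^sub>0\<close> in the algebraic closure. The polynomial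
  \<open>1 + x w\<^sub>0\<close> is a unit modulo \<open>I\<close>, so the generators have no common zero with \<open>x = c\<close>, and an
  effective Nullstellensatz in the remaining variables solves the system at \<open>x = c\<close>. This contradicts
  \<open>w\<^sub>0(c) \<noteq> 0\<close>. The effective Nullstellensatz follows by the same dichotomy and induction on the
  number of variables. The linear case \<open>d = 1\<close>, where the bound is \<open>1\<close>, is again the dichotomy, now with
  constant coefficients.
\<close>

section \<open>Linear algebra over \<open>k[x]\<close> with explicit degree bounds\<close>

section \<open>Linear systems over \<open>k[x]\<close>\<close>

text \<open>Gaussian elimination, one equation at a time: an equation with a nonzero coefficient at
  some \<open>v\<close> serves to eliminate \<open>v\<close> from all the others.\<close>

lemma homogeneous_system_solvable:
  fixes a :: "'e \<Rightarrow> 'u \<Rightarrow> 'k::field"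
  assumes "finite E" "finite U" "card E < card U"
  shows "\<exists>y. (\<exists>u\<in>U. y u \<noteq> 0) \<and> (\<forall>e\<in>E. (\<Sum>u\<in>U. a e u * y u) = 0)"
  using assms
proof (induction E arbitrary: U a rule: finite_induct)
  case empty
  then obtain u where "u \<in> U" by fastforce
  then show ?case by (intro exI[of _ "\<lambda>_. 1"]) auto
next
  case (insert e E)
  show ?case
  proof (cases "\<forall>u\<in>U. a e u = 0")
    case True
    from insert.IH[of U a] insert.prems insert.hyps obtain y where
      "\<exists>u\<in>U. y u \<noteq> 0" "\<forall>e\<in>E. (\<Sum>u\<in>U. a e u * y u) = 0" by auto
    with True show ?thesis by (intro exI[of _ y]) auto
  next
    case False
    then obtain v where v: "v \<in> U" "a e v \<noteq> 0" by blast
    define U' where "U' = U - {v}"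
    have U: "U = insert v U'" "v \<notin> U'" "finite U'"
      using v insert.prems unfolding U'_def by auto
    have "card E < card U'" using insert.prems insert.hyps U by simp
    from insert.IH[OF U(3) this, of "\<lambda>e' u. a e' u - a e' v * a e u / a e v"] obtain y where
      y: "\<exists>u\<in>U'. y u \<noteq> 0" "\<forall>e'\<in>E. (\<Sum>u\<in>U'. (a e' u - a e' v * a e u / a e v) * y u) = 0"
      by blast
    \<comment> \<open>The value at \<open>v\<close> is the one that the equation \<open>e\<close>
      forces once the other unknowns are given.\<close>
    define z where "z = y(v := - (\<Sum>u\<in>U'. a e u * y u) / a e v)"
    have zy: "(\<Sum>u\<in>U'. a e' u * z u) = (\<Sum>u\<in>U'. a e' u * y u)" for e'
      using U(2) by (intro sum.cong) (auto simp: z_def)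
    have "(\<Sum>u\<in>U. a e' u * z u) = (\<Sum>u\<in>U'. (a e' u - a e' v * a e u / a e v) * y u)" for e'
    proof -
      have "(\<Sum>u\<in>U. a e' u * z u) = a e' v * z v + (\<Sum>u\<in>U'. a e' u * y u)"
        using U by (simp add: zy)
      also have "\<dots> = (\<Sum>u\<in>U'. a e' u * y u) - a e' v / a e v * (\<Sum>u\<in>U'. a e u * y u)"
        by (simp add: z_def)
      also have "\<dots> = (\<Sum>u\<in>U'. (a e' u - a e' v * a e u / a e v) * y u)"
        unfolding sum_distrib_left sum_subtractf[symmetric]
        by (intro sum.cong) (auto simp: algebra_simps)
      finally show ?thesis .
    qed
    moreover have "(\<Sum>u\<in>U'. (a e u - a e v * a e u / a e v) * y u) = 0"
      using v(2) by simp
    ultimately have "\<forall>e'\<in>insert e E. (\<Sum>u\<in>U. a e' u * z u) = 0"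
      using y(2) by (metis insertE)
    moreover have "\<exists>u\<in>U. z u \<noteq> 0" using y(1) U by (auto simp: z_def)
    ultimately show ?thesis by blast
  qed
qed

text \<open>A \<open>k\<close>-dimension count: the solutions of degree at most \<open>card E * d\<close> have more
  coefficients than the equations impose linear conditions.\<close>

lemma homogeneous_system_solvable_poly:
  fixes a :: "'e \<Rightarrow> 'u \<Rightarrow> 'k::field poly"
  assumes fin: "finite E" "finite U" and card: "card E < card U"
    and deg: "\<forall>t\<in>E. \<forall>u\<in>U. degree (a t u) \<le> d"
  shows "\<exists>y. (\<exists>u\<in>U. y u \<noteq> 0) \<and> (\<forall>u. degree (y u) \<le> card E * d)
           \<and> (\<forall>t\<in>E. (\<Sum>u\<in>U. a t u * y u) = 0)"
proof -
  define e where "e = card E * d"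
  \<comment> \<open>The unknowns are the coefficients of \<open>y u\<close> up to
    \<open>x^e\<close>, the conditions are the coefficients of each equation up to
    \<open>x^(e + d)\<close>. The choice \<open>e = card E * d\<close> is just large enough for the
    count.\<close>
  have "card (E \<times> {..e+d}) < card (U \<times> {..e})"
  proof -
    have "card (E \<times> {..e+d}) = card E * (e + 1) + e"
      using fin by (simp add: card_cartesian_product e_def algebra_simps)
    also have "\<dots> < (card E + 1) * (e + 1)" by (simp add: algebra_simps)
    also have "\<dots> \<le> card U * (e + 1)" using card by (intro mult_right_mono) auto
    also have "\<dots> = card (U \<times> {..e})" by (simp add: card_cartesian_product)
    finally show ?thesis .
  qed
  from homogeneous_system_solvable[OF _ _ this,
      of "\<lambda>(t, m) (u, l). coeff (a t u * monom 1 l) m"] fin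
  obtain z where z: "\<exists>u\<in>U \<times> {..e}. z u \<noteq> 0"
    "\<And>t m. t \<in> E \<Longrightarrow> m \<le> e+d \<Longrightarrow>
      (\<Sum>(u, l)\<in>U\<times>{..e}. coeff (a t u * monom 1 l) m * z (u, l)) = 0"
    by (auto simp: case_prod_unfold)
  define y where "y u = (\<Sum>l\<le>e. monom (z (u, l)) l)" for u
  have cy: "coeff (y u) l = (if l \<le> e then z (u, l) else 0)" for u l
    by (auto simp: y_def coeff_sum)
  have dy: "degree (y u) \<le> e" for u
    by (rule degree_le) (simp add: cy)
  have "\<exists>u\<in>U. y u \<noteq> 0"
  proof -
    from z(1) obtain u l where "u \<in> U" "l \<le> e" "z (u, l) \<noteq> 0" by auto
    then have "coeff (y u) l \<noteq> 0" by (simp add: cy)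
    then show ?thesis using \<open>u \<in> U\<close> by (metis coeff_0)
  qed
  moreover have "(\<Sum>u\<in>U. a t u * y u) = 0" if t: "t \<in> E" for t
  proof (rule poly_eqI)
    fix m
    have sm: "(\<Sum>u\<in>U. a t u * y u) = (\<Sum>(u, l)\<in>U\<times>{..e}. smult (z (u, l)) (a t u * monom 1 l))"
    proof -
      have "a t u * y u = (\<Sum>l\<le>e. smult (z (u, l)) (a t u * monom 1 l))" for u
        unfolding y_def sum_distrib_left
      proof (rule sum.cong)
        fix l
        have "monom (z (u, l)) l = smult (z (u, l)) (monom 1 l)" by (simp add: smult_monom)
        then show "a t u * monom (z (u, l)) l = smult (z (u, l)) (a t u * monom 1 l)" by simp
      qed simp
      then show ?thesis by (simp add: sum.cartesian_product)
    qed
    show "coeff (\<Sum>u\<in>U. a t u * y u) m = coeff 0 m"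
    proof (cases "m \<le> e + d")
      case True
      have "coeff (\<Sum>u\<in>U. a t u * y u) m
          = (\<Sum>(u, l)\<in>U\<times>{..e}. coeff (a t u * monom 1 l) m * z (u, l))"
        unfolding sm by (simp add: coeff_sum case_prod_unfold mult.commute)
      then show ?thesis using z(2)[OF t True] by simp
    next
      \<comment> \<open>Coefficients beyond \<open>e + d\<close> vanish for degree reasons, so no
        condition was imposed on them.\<close>
      case False
      have "degree (\<Sum>u\<in>U. a t u * y u) \<le> e + d"
      proof (intro degree_sum_le fin(2))
        fix u assume "u \<in> U"
        have "degree (a t u * y u) \<le> degree (a t u) + degree (y u)" by (rule degree_mult_le)
        also have "\<dots> \<le> e + d" using bspec[OF bspec[OF deg t] \<open>u \<in> U\<close>] dy[of u] by linarith
        finally show "degree (a t u * y u) \<le> e + d" .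
      qed
      then show ?thesis using False by (simp add: coeff_eq_0)
    qed
  qed
  ultimately show ?thesis using dy unfolding e_def by blast
qed

section \<open>Independence of polynomial columns over the fraction field\<close>

locale poly_columns =
  fixes c :: "'j \<Rightarrow> 'i \<Rightarrow> 'k::field poly" and S :: "'i set" and J :: "'j set" and d :: nat
  assumes finite_S: "finite S"
    and degree_c: "\<And>j i. j \<in> J \<Longrightarrow> i \<in> S \<Longrightarrow> degree (c j i) \<le> d"
begin

definition indep :: "'j set \<Rightarrow> bool" where
  "indep F \<longleftrightarrow> finite F \<and> (\<forall>y. (\<forall>i\<in>S. (\<Sum>j\<in>F. c j i * y j) = 0) \<longrightarrow> (\<forall>j\<in>F. y j = 0))"

text \<open>The factor \<open>h\<close> clears denominators: this is membership in the span over
  \<open>k(x)\<close>, expressed without forming the fraction field.\<close>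

definition dependent_on :: "'j \<Rightarrow> 'j set \<Rightarrow> bool" where
  "dependent_on v F \<longleftrightarrow> (\<exists>h y. h \<noteq> 0 \<and> (\<forall>i\<in>S. h * c v i = (\<Sum>j\<in>F. c j i * y j)))"

lemma indep_card_le:
  assumes "indep F" "F \<subseteq> J"
  shows "card F \<le> card S"
proof (rule ccontr)
  assume "\<not> card F \<le> card S"
  then have card: "card S < card F" by simp
  have "finite F" using assms unfolding indep_def by blast
  moreover have "\<forall>i\<in>S. \<forall>j\<in>F. degree (c j i) \<le> d"
    using assms(2) by (blast intro: degree_c)
  ultimately obtain y where "\<exists>u\<in>F. y u \<noteq> 0" "\<forall>u. degree (y u) \<le> card S * d"
      "\<forall>t\<in>S. (\<Sum>u\<in>F. c u t * y u) = 0"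
    using homogeneous_system_solvable_poly[OF finite_S _ card, where a = "\<lambda>i j. c j i"] by blast
  then show False using assms unfolding indep_def by blast
qed

lemma dependent_onI:
  assumes F: "indep F" and v: "v \<in> F \<or> \<not> indep (insert v F)"
  shows "dependent_on v F"
proof (cases "v \<in> F")
  case True
  have "finite F" using F unfolding indep_def by blast
  then have "1 * c v i = (\<Sum>j\<in>F. c j i * (if j = v then 1 else 0))" for i
    using True by (simp add: if_distrib cong: if_cong)
  then show ?thesis unfolding dependent_on_def by (metis one_neq_zero)
next
  case False
  have fin: "finite F" using F unfolding indep_def by blast
  then obtain y where y: "\<forall>i\<in>S. (\<Sum>j\<in>insert v F. c j i * y j) = 0" "\<exists>j\<in>insert v F. y j \<noteq> 0"
    using v False unfolding indep_def by blast
  have "y v \<noteq> 0"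
  proof
    assume "y v = 0"
    with y fin False have "\<forall>i\<in>S. (\<Sum>j\<in>F. c j i * y j) = 0" by simp
    then have "\<forall>j\<in>F. y j = 0" using F unfolding indep_def by blast
    with y(2) \<open>y v = 0\<close> show False by blast
  qed
  moreover have "y v * c v i = (\<Sum>j\<in>F. c j i * - y j)" if "i \<in> S" for i
    using y(1)[rule_format, OF that] fin False
    by (simp add: sum_negf eq_neg_iff_add_eq_0 mult.commute)
  ultimately show ?thesis unfolding dependent_on_def by (metis (no_types))
qed

text \<open>The bound of \<open>indep_card_le\<close> makes an independent set of greatest
  cardinality exist between \<open>F0\<close> and \<open>J'\<close>; a column not dependent on it
  could be added.\<close>

lemma maximal_indep:
  assumes "indep F0" "F0 \<subseteq> J'" "J' \<subseteq> J"
  obtains F where "F0 \<subseteq> F" "F \<subseteq> J'" "indep F" "\<forall>v\<in>J'. dependent_on v F"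
proof -
  let ?P = "\<lambda>F. F0 \<subseteq> F \<and> F \<subseteq> J' \<and> indep F"
  have "?P F0" using assms by blast
  moreover have "\<forall>F. ?P F \<longrightarrow> card F < Suc (card S)"
    using indep_card_le assms(3) by (meson le_imp_less_Suc order_trans)
  ultimately have "\<exists>F. ?P F \<and> (\<forall>F'. ?P F' \<longrightarrow> card F' \<le> card F)"
    by (rule ex_has_greatest_nat)
  then obtain F where F: "?P F" "\<And>F'. ?P F' \<Longrightarrow> card F' \<le> card F" by blast
  have "dependent_on v F" if "v \<in> J'" for v
  proof (rule dependent_onI)
    show "v \<in> F \<or> \<not> indep (insert v F)"
    proof (rule ccontr)
      assume *: "\<not> (v \<in> F \<or> \<not> indep (insert v F))"
      then have "card (insert v F) \<le> card F" using F(1) that by (intro F(2)) auto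
      moreover have "finite F" using F(1) unfolding indep_def by blast
      ultimately show False using * by simp
    qed
  qed (use F in blast)
  with F(1) that show ?thesis by blast
qed

text \<open>Orthogonality passes from columns to their span over \<open>k(x)\<close>: multiply by
  \<open>h\<close>, expand, and cancel \<open>h\<close> in the domain \<open>k[x]\<close>.\<close>

lemma orthogonal_dependent:
  assumes "dependent_on v F" "\<And>j. j \<in> F \<Longrightarrow> (\<Sum>i\<in>S. c j i * w i) = 0"
  shows "(\<Sum>i\<in>S. c v i * w i) = 0"
proof -
  obtain h y where h: "h \<noteq> 0" "\<forall>i\<in>S. h * c v i = (\<Sum>j\<in>F. c j i * y j)"
    using assms(1) unfolding dependent_on_def by blast
  have "h * (\<Sum>i\<in>S. c v i * w i) = (\<Sum>i\<in>S. (\<Sum>j\<in>F. c j i * y j) * w i)"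
    unfolding sum_distrib_left using h(2) by (intro sum.cong) (simp_all add: mult.assoc[symmetric])
  also have "\<dots> = (\<Sum>i\<in>S. \<Sum>j\<in>F. y j * (c j i * w i))"
    unfolding sum_distrib_right by (intro sum.cong) (simp_all add: mult_ac)
  also have "\<dots> = (\<Sum>j\<in>F. y j * (\<Sum>i\<in>S. c j i * w i))"
    by (subst sum.swap) (simp add: sum_distrib_left)
  also have "\<dots> = 0" using assms(2) by simp
  finally show ?thesis using h(1) by simp
qed

end

text \<open>Completing a maximal independent set of columns by unit vectors gives square systems,
  so that the degree bounds follow by counting and no minors are needed.\<close>

theorem poly_fredholm_alternative:
  fixes c :: "'j \<Rightarrow> 'i \<Rightarrow> 'k::field poly"
  assumes fin: "finite S" and i0: "i0 \<in> S"
    and deg: "\<forall>j\<in>J. \<forall>i\<in>S. degree (c j i) \<le> d"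
  shows "(\<exists>h F y. h \<noteq> 0 \<and> degree h \<le> card S * d \<and> finite F \<and> F \<subseteq> J
            \<and> (\<forall>j. degree (y j) \<le> card S * d)
            \<and> (\<forall>i\<in>S. (\<Sum>j\<in>F. c j i * y j) = (if i = i0 then h else 0)))
       \<or> (\<exists>w. w i0 \<noteq> 0 \<and> (\<forall>i. degree (w i) \<le> (card S - 1) * d)
            \<and> (\<forall>j\<in>J. (\<Sum>i\<in>S. c j i * w i) = 0))"
proof -
  \<comment> \<open>\<open>Inl\<close> tags the given columns and \<open>Inr\<close> the unit
    vectors; the latter ensure that all columns together span.\<close>
  define c' where "c' = case_sum c (\<lambda>i i'. if i' = i then 1 else (0 :: 'k poly))"
  have c'_simps [simp]: "c' (Inl j) i = c j i" "c' (Inr i') i = (if i = i' then 1 else 0)" for j i i'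
    by (simp_all add: c'_def)
  interpret poly_columns c' S "Inl ` J \<union> Inr ` S" d
    by unfold_locales (use fin deg in auto)
  have unit_orth: "(\<Sum>i\<in>S. c' (Inr i') i * w i) = w i'" if "i' \<in> S" for w :: "'i \<Rightarrow> 'k poly" and i'
    using fin that by (simp add: if_distrib[of "\<lambda>x. x * w _"] sum.delta cong: if_cong)
  have "indep {}" by (simp add: indep_def)
  from maximal_indep[OF this, of "Inl ` J"] obtain F0 where
    F0: "F0 \<subseteq> Inl ` J" "indep F0" "\<forall>v\<in>Inl ` J. dependent_on v F0" by auto
  have i0_in: "Inr i0 \<in> Inr ` S" using i0 by simp
  \<comment> \<open>The alternative is whether the unit vector at \<open>i0\<close> lies in the span
    of the given columns over \<open>k(x)\<close>.\<close>
  show ?thesis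
  proof (cases "dependent_on (Inr i0) F0")
    case True
    have sub: "F0 \<subseteq> F0 \<union> Inr ` S" "F0 \<union> Inr ` S \<subseteq> Inl ` J \<union> Inr ` S"
      using F0(1) by auto
    obtain B where B: "F0 \<subseteq> B" "B \<subseteq> F0 \<union> Inr ` S" "indep B"
        "\<forall>v\<in>F0 \<union> Inr ` S. dependent_on v B"
      by (rule maximal_indep[OF F0(2) sub])
    have finB: "finite B" using B(3) unfolding indep_def by blast
    have BJ: "B \<subseteq> Inl ` J \<union> Inr ` S" using B(2) F0(1) by blast
    \<comment> \<open>With fewer columns some nonzero \<open>w\<close> would be orthogonal to
      \<open>B\<close>, hence to every unit vector.\<close>
    have "card S \<le> card B"
    proof (rule ccontr)
      assume "\<not> card S \<le> card B"
      then have card: "card B < card S" by simp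
      have "\<forall>j\<in>B. \<forall>i\<in>S. degree (c' j i) \<le> d"
        using BJ by (blast intro: degree_c)
      from homogeneous_system_solvable_poly[where a = c', OF finB fin card this]
      obtain w where w: "\<exists>i\<in>S. w i \<noteq> 0" "\<forall>i. degree (w i) \<le> card B * d"
          "\<forall>j\<in>B. (\<Sum>i\<in>S. c' j i * w i) = 0"
        by (elim exE conjE) (rule that)
      have "w i = 0" if "i \<in> S" for i
      proof -
        have "(\<Sum>i'\<in>S. c' (Inr i) i' * w i') = 0"
          by (rule orthogonal_dependent[OF bspec[OF B(4)]]) (use w(3) that in blast)+
        then show ?thesis using unit_orth[OF that] by simp
      qed
      then show False using w(1) by blast
    qed
    obtain h0 y0 where h0: "h0 \<noteq> 0" "\<forall>i\<in>S. h0 * c' (Inr i0) i = (\<Sum>j\<in>F0. c' j i * y0 j)"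
      using True unfolding dependent_on_def by blast
    \<comment> \<open>The index \<open>None\<close> for the unit vector at \<open>i0\<close> keeps
      it apart from \<open>B\<close> by construction. With it there are more columns than rows,
      which yields a relation of bounded degree, unlike the one given by \<open>h0\<close>.\<close>
    define C where "C = (\<lambda>v. case v of None \<Rightarrow> c' (Inr i0) | Some v \<Rightarrow> c' v)"
    have card: "card S < card (insert None (Some ` B))"
      using \<open>card S \<le> card B\<close> finB by (simp add: card_image)
    have deg': "\<forall>i\<in>S. \<forall>v\<in>insert None (Some ` B). degree (C v i) \<le> d"
      using degree_c BJ i0_in unfolding C_def by (auto simp del: c'_simps)
    have "finite (insert None (Some ` B))" using finB by simp
    from homogeneous_system_solvable_poly[where a = "\<lambda>i v. C v i", OF fin this card deg']
    obtain y where y: "\<exists>u\<in>insert None (Some ` B). y u \<noteq> 0" "\<forall>u. degree (y u) \<le> card S * d"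
        "\<forall>t\<in>S. (\<Sum>u\<in>insert None (Some ` B). C u t * y u) = 0"
      by (elim exE conjE) (rule that)
    have y3: "c' (Inr i0) i * y None + (\<Sum>j\<in>B. c' j i * y (Some j)) = 0" if "i \<in> S" for i
      using y(3)[rule_format, OF that] finB by (simp add: C_def sum.reindex del: c'_simps)
    \<comment> \<open>Scaling the relation by \<open>h0\<close> and expanding \<open>h0\<close>
      times the unit vector over \<open>F0\<close> leaves a relation on \<open>B\<close> alone, so
      all its coefficients vanish. Off \<open>F0\<close> they are
      \<open>h0 * y (Some j)\<close>.\<close>
    have "y (Some j) = 0" if "j \<in> B - F0" for j
    proof -
      define z where "z j = h0 * y (Some j) + (if j \<in> F0 then y None * y0 j else 0)" for j
      have "(\<Sum>j\<in>B. c' j i * z j) = 0" if i: "i \<in> S" for i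
      proof -
        have "(\<Sum>j\<in>B. c' j i * (if j \<in> F0 then y None * y0 j else 0))
              = (\<Sum>j\<in>F0. c' j i * (y None * y0 j))"
          by (rule sum.mono_neutral_cong_right) (use finB B(1) in auto)
        also have "\<dots> = y None * (h0 * c' (Inr i0) i)"
          using h0(2) i by (simp add: sum_distrib_left mult_ac del: c'_simps)
        finally have "(\<Sum>j\<in>B. c' j i * z j)
              = h0 * (c' (Inr i0) i * y None + (\<Sum>j\<in>B. c' j i * y (Some j)))"
          unfolding z_def
          by (simp add: distrib_left sum.distrib sum_distrib_left mult_ac del: c'_simps)
        then show ?thesis using y3[OF i] by simp
      qed
      then have "z j = 0" using B(3) that unfolding indep_def by blast
      then show ?thesis using that h0(1) by (simp add: z_def)
    qed
    then have y4: "c' (Inr i0) i * y None + (\<Sum>j\<in>F0. c' j i * y (Some j)) = 0" if "i \<in> S" for i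
      using y3[OF that] sum.mono_neutral_right[of B F0 "\<lambda>j. c' j i * y (Some j)"] finB B(1)
      by simp
    have "y None \<noteq> 0"
    proof
      assume 0: "y None = 0"
      then have "\<forall>i\<in>S. (\<Sum>j\<in>B. c' j i * y (Some j)) = 0" using y3 by simp
      then have "\<forall>j\<in>B. y (Some j) = 0"
        using spec[OF conjunct2[OF B(3)[unfolded indep_def]], of "\<lambda>j. y (Some j)"] by blast
      then show False using y(1) 0 by blast
    qed
    obtain F where F: "F \<subseteq> J" "F0 = Inl ` F" using F0(1) by (meson subset_imageE)
    have "finite F0" using F0(2) unfolding indep_def by blast
    then have "finite F" using F(2) by (simp add: finite_image_iff)
    moreover have "(\<Sum>j\<in>F. c j i * - y (Some (Inl j))) = (if i = i0 then y None else 0)"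
      if "i \<in> S" for i
    proof -
      have "(\<Sum>j\<in>F. c j i * - y (Some (Inl j))) = - (\<Sum>j\<in>F0. c' j i * y (Some j))"
        unfolding F(2) by (simp add: sum.reindex sum_negf)
      also have "\<dots> = c' (Inr i0) i * y None"
        using y4[OF that] by (metis add_eq_0_iff2)
      finally show ?thesis by simp
    qed
    moreover have "\<forall>j. degree (- y (Some (Inl j))) \<le> card S * d" using y(2) by simp
    ultimately have "y None \<noteq> 0 \<and> degree (y None) \<le> card S * d \<and> finite F \<and> F \<subseteq> J
            \<and> (\<forall>j. degree (- y (Some (Inl j))) \<le> card S * d)
            \<and> (\<forall>i\<in>S. (\<Sum>j\<in>F. c j i * - y (Some (Inl j))) = (if i = i0 then y None else 0))"
      using F(1) \<open>y None \<noteq> 0\<close> spec[OF y(2), of None] by (intro conjI ballI)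
    note * = this
    show ?thesis
      by (rule disjI1, rule exI[of _ "y None"], rule exI[of _ F],
          rule exI[of _ "\<lambda>j. - y (Some (Inl j))"], rule *)
  next
    case False
    then have indep: "indep (insert (Inr i0) F0)" using dependent_onI[OF F0(2)] by blast
    have sub: "insert (Inr i0) F0 \<subseteq> F0 \<union> Inr ` S" "F0 \<union> Inr ` S \<subseteq> Inl ` J \<union> Inr ` S"
      using F0(1) i0_in by auto
    obtain B where B: "insert (Inr i0) F0 \<subseteq> B" "B \<subseteq> F0 \<union> Inr ` S" "indep B"
        "\<forall>v\<in>F0 \<union> Inr ` S. dependent_on v B"
      by (rule maximal_indep[OF indep sub])
    have finB: "finite B" using B(3) unfolding indep_def by blast
    have BJ: "B \<subseteq> Inl ` J \<union> Inr ` S" using B(2) F0(1) by blast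
    \<comment> \<open>Dropping the unit vector at \<open>i0\<close> leaves fewer than
      \<open>card S\<close> orthogonality conditions. They have a nonzero solution \<open>w\<close>,
      and their number gives the factor \<open>card S - 1\<close> in its degree bound.\<close>
    define B' where "B' = B - {Inr i0}"
    have cB: "card B \<le> card S" by (rule indep_card_le[OF B(3) BJ])
    have cB': "card B' < card B" unfolding B'_def using B(1) finB by (intro psubset_card_mono) auto
    have "finite B'" using finB unfolding B'_def by simp
    moreover have "\<forall>j\<in>B'. \<forall>i\<in>S. degree (c' j i) \<le> d"
      using BJ unfolding B'_def by (blast intro: degree_c)
    note homogeneous_system_solvable_poly[where a = c', OF calculation fin less_le_trans[OF cB' cB] this]
    then obtain w where w: "\<exists>i\<in>S. w i \<noteq> 0" "\<forall>i. degree (w i) \<le> card B' * d"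
        "\<forall>j\<in>B'. (\<Sum>i\<in>S. c' j i * w i) = 0"
      by (elim exE conjE) (rule that)
    \<comment> \<open>Otherwise \<open>w\<close> would be orthogonal to all of \<open>B\<close>,
      hence to every unit vector.\<close>
    have "w i0 \<noteq> 0"
    proof
      assume "w i0 = 0"
      then have orth: "(\<Sum>i\<in>S. c' j i * w i) = 0" if "j \<in> B" for j
        using w(3) that unit_orth[OF i0, of w] unfolding B'_def by (cases "j = Inr i0") (simp_all del: c'_simps)
      have "w i = 0" if "i \<in> S" for i
      proof -
        have "(\<Sum>i'\<in>S. c' (Inr i) i' * w i') = 0"
          by (rule orthogonal_dependent[OF bspec[OF B(4)]]) (use orth that in blast)+
        then show ?thesis using unit_orth[OF that] by simp
      qed
      then show False using w(1) by blast
    qed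
    moreover have "(\<Sum>i\<in>S. c j i * w i) = 0" if "j \<in> J" for j
    proof -
      have "Inr i0 \<notin> F0" using F0(1) by blast
      then have "F0 \<subseteq> B'" using B(1) unfolding B'_def by blast
      then have orth: "\<forall>j\<in>F0. (\<Sum>i\<in>S. c' j i * w i) = 0" using w(3) by blast
      have "(\<Sum>i\<in>S. c' (Inl j) i * w i) = 0"
        by (rule orthogonal_dependent[OF bspec[OF F0(3) imageI[OF that]] bspec[OF orth]])
      then show ?thesis unfolding c'_simps .
    qed
    moreover have "card B' * d \<le> (card S - 1) * d" using cB cB' by (intro mult_right_mono) auto
    then have "\<forall>i. degree (w i) \<le> (card S - 1) * d" using w(2) by (meson order_trans)
    moreover note \<open>\<forall>i. degree (w i) \<le> (card S - 1) * d\<close>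
    ultimately have "w i0 \<noteq> 0 \<and> (\<forall>i. degree (w i) \<le> (card S - 1) * d)
            \<and> (\<forall>j\<in>J. (\<Sum>i\<in>S. c j i * w i) = 0)"
      by (intro conjI ballI)
    then show ?thesis by (intro disjI2 exI[of _ w])
  qed
qed

section \<open>Monomials, total degree and spaces of polynomials of bounded degree\<close>

section \<open>Multivariate polynomials of bounded degree\<close>

abbreviation mkeys :: "('a \<Rightarrow>\<^sub>0 'b::zero) \<Rightarrow> 'a set" where "mkeys \<equiv> Poly_Mapping.keys"
abbreviation lookup :: "('a \<Rightarrow>\<^sub>0 'b::zero) \<Rightarrow> 'a \<Rightarrow> 'b" where "lookup \<equiv> Poly_Mapping.lookup"
abbreviation single :: "'a \<Rightarrow> 'b \<Rightarrow> 'a \<Rightarrow>\<^sub>0 'b::zero" where "single \<equiv> Poly_Mapping.single"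

definition mon_degree :: "(nat \<Rightarrow>\<^sub>0 nat) \<Rightarrow> nat" where
  "mon_degree m = (\<Sum>i\<in>mkeys m. lookup m i)"

lemma mon_degree_superset:
  assumes "finite A" "mkeys m \<subseteq> A"
  shows "mon_degree m = (\<Sum>i\<in>A. lookup m i)"
  unfolding mon_degree_def
  by (rule sum.mono_neutral_left) (use assms in \<open>auto simp: in_keys_iff\<close>)

lemma mon_degree_0 [simp]: "mon_degree 0 = 0"
  by (simp add: mon_degree_def)

lemma mon_degree_add: "mon_degree (a + b) = mon_degree a + mon_degree b"
proof -
  have "mkeys (a + b) \<subseteq> mkeys a \<union> mkeys b" by (rule Poly_Mapping.keys_add)
  then show ?thesis
    by (simp add: mon_degree_superset[of "mkeys a \<union> mkeys b"] lookup_add sum.distrib)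
qed

lemma mon_degree_single [simp]: "mon_degree (single i k) = k"
  by (simp add: mon_degree_def)

definition bounded_polys :: "nat set \<Rightarrow> nat \<Rightarrow> 'a::zero mpoly set" where
  "bounded_polys V e = {p. \<forall>m\<in>mkeys p. mkeys m \<subseteq> V \<and> mon_degree m \<le> e}"

lemma poly_mapping_eq_sum_single:
  fixes p :: "'a \<Rightarrow>\<^sub>0 'b::comm_monoid_add"
  shows "p = (\<Sum>m\<in>mkeys p. single m (lookup p m))"
proof (rule poly_mapping_eqI)
  fix k
  have "lookup (\<Sum>m\<in>mkeys p. single m (lookup p m)) k
      = (\<Sum>m\<in>mkeys p. if m = k then lookup p m else 0)"
    unfolding lookup_sum by (intro sum.cong) (auto simp: lookup_single when_def)
  then show "lookup p k = lookup (\<Sum>m\<in>mkeys p. single m (lookup p m)) k"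
    by (simp add: in_keys_iff)
qed

lemma poly_mapping_single_induct [case_names zero single add]:
  fixes p :: "'a \<Rightarrow>\<^sub>0 'b::comm_monoid_add"
  assumes "P 0" "\<And>m. m \<in> mkeys p \<Longrightarrow> P (single m (lookup p m))"
    and "\<And>q r. P q \<Longrightarrow> P r \<Longrightarrow> P (q + r)"
  shows "P p"
proof -
  have "P (\<Sum>m\<in>A. single m (lookup p m))" if "finite A" "A \<subseteq> mkeys p" for A
    using that by (induction A) (use assms in auto)
  from this[of "mkeys p"] show ?thesis using poly_mapping_eq_sum_single[of p] by simp
qed

lemma additive_eqI:
  fixes f g :: "('a \<Rightarrow>\<^sub>0 'b::comm_monoid_add) \<Rightarrow> 'c::comm_monoid_add"
  assumes "f 0 = 0" "g 0 = 0" "\<And>p q. f (p + q) = f p + f q" "\<And>p q. g (p + q) = g p + g q"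
    and "\<And>m c. f (single m c) = g (single m c)"
  shows "f p = g p"
  by (induction p rule: poly_mapping_single_induct) (simp_all add: assms)

lemma bounded_polys_0 [simp]: "0 \<in> bounded_polys V e"
  by (simp add: bounded_polys_def)

lemma bounded_polys_add:
  "p \<in> bounded_polys V e \<Longrightarrow> q \<in> bounded_polys V e \<Longrightarrow> p + q \<in> bounded_polys V e"
  using Poly_Mapping.keys_add[of p q] unfolding bounded_polys_def by blast

lemma bounded_polys_sum:
  "(\<And>i. i \<in> A \<Longrightarrow> f i \<in> bounded_polys V e) \<Longrightarrow> (\<Sum>i\<in>A. f i) \<in> bounded_polys V e"
  by (induction A rule: infinite_finite_induct) (auto intro: bounded_polys_add)

lemma bounded_polys_uminus:
  fixes p :: "'a::ab_group_add mpoly"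
  shows "p \<in> bounded_polys V e \<Longrightarrow> - p \<in> bounded_polys V e"
  by (simp add: bounded_polys_def in_keys_iff)

lemma bounded_polys_diff:
  fixes p :: "'a::ab_group_add mpoly"
  shows "p \<in> bounded_polys V e \<Longrightarrow> q \<in> bounded_polys V e \<Longrightarrow> p - q \<in> bounded_polys V e"
  using bounded_polys_add[of p V e "- q"] bounded_polys_uminus[of q] by simp

lemma bounded_polys_mono:
  "p \<in> bounded_polys V e \<Longrightarrow> V \<subseteq> V' \<Longrightarrow> e \<le> e' \<Longrightarrow> p \<in> bounded_polys V' e'"
  unfolding bounded_polys_def by fastforce

lemma bounded_polys_single:
  "mkeys m \<subseteq> V \<Longrightarrow> mon_degree m \<le> e \<Longrightarrow> single m c \<in> bounded_polys V e"
  by (simp add: bounded_polys_def)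

lemma bounded_polys_mult:
  fixes p q :: "'a::comm_semiring_0 mpoly"
  assumes "p \<in> bounded_polys V e" "q \<in> bounded_polys V e'"
  shows "p * q \<in> bounded_polys V (e + e')"
  unfolding bounded_polys_def
proof (intro CollectI ballI)
  fix m assume "m \<in> mkeys (p * q)"
  with keys_mult[of p q] obtain a b where
    ab: "m = a + b" "a \<in> mkeys p" "b \<in> mkeys q" by blast
  then have "mkeys a \<subseteq> V" "mkeys b \<subseteq> V" "mon_degree a \<le> e" "mon_degree b \<le> e'"
    using assms unfolding bounded_polys_def by blast+
  then show "mkeys m \<subseteq> V \<and> mon_degree m \<le> e + e'"
    using Poly_Mapping.keys_add[of a b] ab(1) by (auto simp: mon_degree_add)
qed

lemma bounded_polys_induct [consumes 1, case_names zero single add]: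
  fixes p :: "'a::comm_monoid_add mpoly"
  assumes "p \<in> bounded_polys V e" "P 0"
    and "\<And>m c. mkeys m \<subseteq> V \<Longrightarrow> mon_degree m \<le> e \<Longrightarrow> P (single m c)"
    and "\<And>q r. P q \<Longrightarrow> P r \<Longrightarrow> P (q + r)"
  shows "P p"
  by (rule poly_mapping_single_induct) (use assms in \<open>auto simp: bounded_polys_def\<close>)

abbreviation Const :: "'a::zero \<Rightarrow> 'a mpoly" where "Const c \<equiv> single 0 c"

definition Var :: "nat \<Rightarrow> 'a::zero_neq_one mpoly" where "Var x = single (single x 1) 1"

lemma Var_bounded: "x \<in> V \<Longrightarrow> Var x \<in> bounded_polys V 1"
  unfolding Var_def by (rule bounded_polys_single) auto

lemma lookup_Const_mult: "lookup (Const a * p) m = a * lookup (p :: 'a::comm_semiring_0 mpoly) m"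
  by (simp add: mult_map_scale_conv_mult[symmetric] map.rep_eq when_def)

section \<open>Homomorphisms that substitute values for variables\<close>

section \<open>Additive extension and evaluation\<close>

text \<open>Evaluation and the separation of a variable are both instances, so their additivity has
  one common proof.\<close>

definition additive_ext :: "('a \<Rightarrow> 'b::comm_monoid_add \<Rightarrow> 'c::comm_monoid_add) \<Rightarrow> ('a \<Rightarrow>\<^sub>0 'b) \<Rightarrow> 'c" where
  "additive_ext f p = (\<Sum>m\<in>mkeys p. f m (lookup p m))"

lemma additive_ext_0 [simp]: "additive_ext f 0 = 0"
  by (simp add: additive_ext_def)

lemma additive_ext_superset:
  assumes "finite A" "mkeys p \<subseteq> A" "\<And>m. f m 0 = 0"
  shows "additive_ext f p = (\<Sum>m\<in>A. f m (lookup p m))"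
  unfolding additive_ext_def
  by (rule sum.mono_neutral_left) (use assms in \<open>auto simp: in_keys_iff\<close>)

lemma additive_ext_add:
  assumes "\<And>m. f m 0 = 0" "\<And>m a b. f m (a + b) = f m a + f m b"
  shows "additive_ext f (p + q) = additive_ext f p + additive_ext f q"
proof -
  have "mkeys (p + q) \<subseteq> mkeys p \<union> mkeys q" by (rule Poly_Mapping.keys_add)
  then show ?thesis
    by (simp add: additive_ext_superset[of "mkeys p \<union> mkeys q"] assms lookup_add sum.distrib)
qed

lemma additive_ext_single: "f m 0 = 0 \<Longrightarrow> additive_ext f (single m c) = f m c"
  by (cases "c = 0") (simp_all add: additive_ext_def)

definition mon_eval :: "(nat \<Rightarrow> 'a::comm_monoid_mult) \<Rightarrow> (nat \<Rightarrow>\<^sub>0 nat) \<Rightarrow> 'a" where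
  "mon_eval a m = (\<Prod>i\<in>mkeys m. a i ^ lookup m i)"

lemma mon_eval_superset:
  assumes "finite A" "mkeys m \<subseteq> A"
  shows "mon_eval a m = (\<Prod>i\<in>A. a i ^ lookup m i)"
  unfolding mon_eval_def
  by (rule prod.mono_neutral_left) (use assms in \<open>auto simp: in_keys_iff\<close>)

lemma mon_eval_0 [simp]: "mon_eval a 0 = 1"
  by (simp add: mon_eval_def)

lemma mon_eval_add: "mon_eval a (m + m') = mon_eval a m * mon_eval a m'"
proof -
  have "mkeys (m + m') \<subseteq> mkeys m \<union> mkeys m'" by (rule Poly_Mapping.keys_add)
  then show ?thesis
    by (simp add: mon_eval_superset[of "mkeys m \<union> mkeys m'"] lookup_add prod.distrib power_add)
qed

lemma mon_eval_single [simp]: "mon_eval a (single i k) = a i ^ k"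
  by (simp add: mon_eval_def)

lemma mon_eval_cong: "(\<And>i. i \<in> mkeys m \<Longrightarrow> a i = b i) \<Longrightarrow> mon_eval a m = mon_eval b m"
  unfolding mon_eval_def by (intro prod.cong) auto

definition is_hom :: "('a::comm_ring_1 \<Rightarrow> 'b::comm_ring_1) \<Rightarrow> bool" where
  "is_hom f \<longleftrightarrow> f 1 = 1 \<and> (\<forall>x y. f (x + y) = f x + f y) \<and> (\<forall>x y. f (x * y) = f x * f y)"

lemma is_homD:
  assumes "is_hom f"
  shows "f 1 = 1" "f (x + y) = f x + f y" "f (x * y) = f x * f y" "f 0 = 0"
proof -
  show "f 1 = 1" "f (x + y) = f x + f y" "f (x * y) = f x * f y"
    using assms by (auto simp: is_hom_def)
  have "f (0 + 0) = f 0 + f 0" using assms unfolding is_hom_def by blast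
  then show "f 0 = 0" by simp
qed

lemma is_hom_id: "is_hom (\<lambda>x. x)"
  by (simp add: is_hom_def)

lemma is_hom_sum: "is_hom f \<Longrightarrow> f (\<Sum>i\<in>A. g i) = (\<Sum>i\<in>A. f (g i))"
  by (induction A rule: infinite_finite_induct) (simp_all add: is_homD)

lemma is_hom_uminus: "is_hom f \<Longrightarrow> f (- x) = - f x"
  using is_homD(2)[of f x "- x"] is_homD(4)[of f] by (simp add: eq_neg_iff_add_eq_0 add.commute)

lemma is_hom_diff: "is_hom f \<Longrightarrow> f (x - y) = f x - f y"
  using is_homD(2)[of f x "- y"] is_hom_uminus[of f y] by simp

lemma is_hom_power: "is_hom f \<Longrightarrow> f (x ^ n) = f x ^ n"
  by (induction n) (simp_all add: is_homD)

lemma is_hom_Const: "is_hom (Const :: 'a::comm_ring_1 \<Rightarrow> 'a mpoly)"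
  by (simp add: is_hom_def single_add mult_single)

definition eval_mpoly ::
    "('a::comm_ring_1 \<Rightarrow> 'b::comm_ring_1) \<Rightarrow> (nat \<Rightarrow> 'b) \<Rightarrow> 'a mpoly \<Rightarrow> 'b" where
  "eval_mpoly f a = additive_ext (\<lambda>m c. f c * mon_eval a m)"

lemma eval_mpoly_single: "is_hom f \<Longrightarrow> eval_mpoly f a (single m c) = f c * mon_eval a m"
  unfolding eval_mpoly_def by (subst additive_ext_single) (simp_all add: is_homD)

lemma eval_mpoly_add: "is_hom f \<Longrightarrow> eval_mpoly f a (p + q) = eval_mpoly f a p + eval_mpoly f a q"
  unfolding eval_mpoly_def by (rule additive_ext_add) (simp_all add: is_homD distrib_right)

lemma eval_mpoly_0 [simp]: "eval_mpoly f a 0 = 0"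
  by (simp add: eval_mpoly_def)

lemma is_hom_eval_mpoly:
  assumes f: "is_hom f"
  shows "is_hom (eval_mpoly f a)"
proof -
  have "eval_mpoly f a (p * q) = eval_mpoly f a p * eval_mpoly f a q" for p q
  proof (induction p rule: poly_mapping_single_induct)
    case (single m)
    show ?case
    proof (induction q rule: poly_mapping_single_induct)
      case (single m')
      show ?case
        by (simp add: f mult_single eval_mpoly_single mon_eval_add is_homD mult_ac)
    qed (simp_all add: f eval_mpoly_add distrib_left)
  qed (simp_all add: f eval_mpoly_add distrib_right)
  moreover have "eval_mpoly f a 1 = 1"
    using eval_mpoly_single[OF f, of a 0 1] f by (simp add: is_homD)
  ultimately show ?thesis
    unfolding is_hom_def using eval_mpoly_add[OF f] by blast
qed

text \<open>With \<open>Const\<close> and \<open>Var x\<close> this embeds \<open>k[x]\<close> into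
  the multivariate ring; with a field embedding and a scalar it is evaluation at a point of an
  extension field.\<close>

definition poly_eval :: "('a::comm_ring_1 \<Rightarrow> 'b::comm_ring_1) \<Rightarrow> 'b \<Rightarrow> 'a poly \<Rightarrow> 'b" where
  "poly_eval f c q = poly (map_poly f q) c"

lemma is_hom_poly_eval:
  assumes f: "is_hom f"
  shows "is_hom (poly_eval f c)"
proof -
  have "map_poly f (p + q) = map_poly f p + map_poly f q" for p q
    by (rule poly_eqI) (simp add: coeff_map_poly f is_homD)
  moreover have "map_poly f (p * q) = map_poly f p * map_poly f q" for p q
    by (rule poly_eqI) (simp add: coeff_map_poly f is_homD coeff_mult is_hom_sum)
  ultimately show ?thesis
    unfolding is_hom_def poly_eval_def by (simp add: is_homD(1)[OF f])
qed

lemma poly_eval_monom: "is_hom f \<Longrightarrow> poly_eval f c (monom a n) = f a * c ^ n"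
  by (simp add: poly_eval_def map_poly_monom is_homD poly_monom)

lemma poly_eval_const: "is_hom f \<Longrightarrow> poly_eval f c [:a:] = f a"
  using poly_eval_monom[of f c a 0] by (simp add: monom_0)

lemma poly_eval_X: "is_hom f \<Longrightarrow> poly_eval f c [:0, 1:] = c"
  using poly_eval_monom[of f c 1 1] by (simp add: is_homD monom_altdef)

section \<open>Passing between \<open>k[x, Y]\<close> and \<open>k[x][Y]\<close>\<close>

section \<open>Separating one variable\<close>

lemma mon_split:
  fixes m :: "nat \<Rightarrow>\<^sub>0 nat"
  shows "m = (m - single x (lookup m x)) + single x (lookup m x)"
  by (rule poly_mapping_eqI) (simp add: lookup_add lookup_minus lookup_single when_def)

lemma keys_mon_split: "mkeys (m - single x (lookup m x)) = mkeys m - {x}"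
  for m :: "nat \<Rightarrow>\<^sub>0 nat"
  by (auto simp: in_keys_iff lookup_minus lookup_single when_def split: if_splits)

lemma mon_degree_split:
  "mon_degree m = mon_degree (m - single x (lookup m x)) + lookup m x"
  by (subst mon_split[of m x]) (simp only: mon_degree_add mon_degree_single)

text \<open>Powers of \<open>x\<close> move into the coefficients, which turns a generator into a
  vector over \<open>k[x]\<close> indexed by monomials in the other variables.\<close>

definition split_var :: "nat \<Rightarrow> 'a::comm_ring_1 mpoly \<Rightarrow> 'a poly mpoly" where
  "split_var x = additive_ext (\<lambda>m c. single (m - single x (lookup m x)) (monom c (lookup m x)))"

text \<open>Being an evaluation, this is a ring homomorphism, so relations found over
  \<open>k[x]\<close> carry back to the original ring.\<close>

definition join_var :: "nat \<Rightarrow> 'a::comm_ring_1 poly mpoly \<Rightarrow> 'a mpoly" where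
  "join_var x = eval_mpoly (poly_eval Const (Var x)) Var"

lemma split_var_0 [simp]: "split_var x 0 = 0"
  by (simp add: split_var_def)

lemma split_var_add: "split_var x (p + q) = split_var x p + split_var x q"
  unfolding split_var_def by (rule additive_ext_add) (simp_all add: add_monom[symmetric] single_add)

lemma split_var_single:
  "split_var x (single m c) = single (m - single x (lookup m x)) (monom c (lookup m x))"
  unfolding split_var_def by (rule additive_ext_single) simp

lemma is_hom_join_var: "is_hom (join_var x)"
  unfolding join_var_def by (intro is_hom_eval_mpoly is_hom_poly_eval is_hom_Const)

lemma prod_single:
  "(\<Prod>i\<in>A. single (f i) 1 :: 'b::comm_semiring_1 mpoly) = single (\<Sum>i\<in>A. f i) 1"
  by (induction A rule: infinite_finite_induct) (simp_all add: mult_single)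

lemma Var_power: "Var x ^ k = (single (single x k) 1 :: 'a::comm_ring_1 mpoly)"
  by (induction k) (simp_all add: Var_def mult_single single_add[symmetric])

lemma mon_eval_Var: "mon_eval Var m = (single m 1 :: 'a::comm_ring_1 mpoly)"
  unfolding mon_eval_def Var_power prod_single
  using poly_mapping_eq_sum_single[of m] by simp

lemma join_var_single:
  "join_var x (single m q) = poly_eval Const (Var x) q * single m 1"
  unfolding join_var_def
  by (simp add: eval_mpoly_single is_hom_poly_eval is_hom_Const mon_eval_Var)

lemma join_split_var: "join_var x (split_var x p) = p"
proof (rule additive_eqI[where f = "\<lambda>p. join_var x (split_var x p)" and g = "\<lambda>p. p"])
  fix m :: "nat \<Rightarrow>\<^sub>0 nat" and c :: 'a
  show "join_var x (split_var x (single m c)) = single m c"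
    using mon_split[of m x]
    by (simp add: split_var_single join_var_single poly_eval_monom is_hom_Const Var_power
        mult_single add.commute)
qed (simp_all add: split_var_add is_homD[OF is_hom_join_var])

lemma poly_eval_bounded:
  assumes "x \<in> V" "degree q \<le> e"
  shows "poly_eval Const (Var x) q \<in> bounded_polys V e"
proof -
  have "poly_eval Const (Var x) q
      = (\<Sum>l\<le>degree q. poly_eval Const (Var x) (monom (coeff q l) l))"
    by (subst poly_as_sum_of_monoms[of q, symmetric])
       (rule is_hom_sum[OF is_hom_poly_eval[OF is_hom_Const]])
  also have "\<dots> \<in> bounded_polys V e"
  proof (rule bounded_polys_sum)
    fix l assume "l \<in> {..degree q}"
    then have "single (single x l) (coeff q l) \<in> bounded_polys V e"
      using assms by (intro bounded_polys_single) auto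
    then show "poly_eval Const (Var x) (monom (coeff q l) l) \<in> bounded_polys V e"
      by (simp add: poly_eval_monom is_hom_Const Var_power mult_single)
  qed
  finally show ?thesis .
qed

text \<open>The degree in \<open>x\<close> hidden in the coefficients is counted too: this is the
  total degree before the separation.\<close>

definition joint_bounded :: "nat set \<Rightarrow> nat \<Rightarrow> 'a::zero poly mpoly set" where
  "joint_bounded V e =
     {Q. \<forall>m\<in>mkeys Q. mkeys m \<subseteq> V \<and> mon_degree m + degree (lookup Q m) \<le> e}"

lemma joint_boundedD:
  assumes "Q \<in> joint_bounded V e"
  shows "Q \<in> bounded_polys V e" "degree (lookup Q m) \<le> e"
proof -
  show "Q \<in> bounded_polys V e"
    using assms unfolding joint_bounded_def bounded_polys_def by fastforce
  show "degree (lookup Q m) \<le> e"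
  proof (cases "m \<in> mkeys Q")
    case True
    then show ?thesis using assms unfolding joint_bounded_def by fastforce
  qed (simp add: in_keys_iff)
qed

lemma joint_bounded_add:
  assumes "P \<in> joint_bounded V e" "Q \<in> joint_bounded V e"
  shows "P + Q \<in> joint_bounded V e"
  unfolding joint_bounded_def
proof (intro CollectI ballI)
  fix m assume "m \<in> mkeys (P + Q)"
  then have m: "m \<in> mkeys P \<or> m \<in> mkeys Q" using Poly_Mapping.keys_add[of P Q] by blast
  have P: "mkeys m \<subseteq> V \<and> mon_degree m + degree (lookup P m) \<le> e" if "m \<in> mkeys P"
    using assms(1) that unfolding joint_bounded_def by blast
  have Q: "mkeys m \<subseteq> V \<and> mon_degree m + degree (lookup Q m) \<le> e" if "m \<in> mkeys Q"
    using assms(2) that unfolding joint_bounded_def by blast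
  have "degree (lookup (P + Q) m) \<le> max (degree (lookup P m)) (degree (lookup Q m))"
    unfolding lookup_add by (rule degree_add_le_max)
  then show "mkeys m \<subseteq> V \<and> mon_degree m + degree (lookup (P + Q) m) \<le> e"
    using m P Q by (cases "m \<in> mkeys P"; cases "m \<in> mkeys Q") (auto simp: in_keys_iff)
qed

lemma split_var_bounded:
  assumes "p \<in> bounded_polys (insert x V) e"
  shows "split_var x p \<in> joint_bounded V e"
  using assms
proof (induction p rule: bounded_polys_induct)
  case (single m c)
  have "degree (monom c (lookup m x)) \<le> lookup m x" by (rule degree_monom_le)
  then show ?case
    using single mon_degree_split[of m x] keys_mon_split[of m x]
    by (auto simp: split_var_single joint_bounded_def)
next
  case zero
  show ?case by (simp add: joint_bounded_def)
qed (simp add: split_var_add joint_bounded_add)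

section \<open>Substituting a scalar for the separated variable\<close>

abbreviation map_coeffs :: "('a::zero \<Rightarrow> 'b::zero) \<Rightarrow> 'a mpoly \<Rightarrow> 'b mpoly" where
  "map_coeffs \<equiv> Poly_Mapping.map"

lemma lookup_map_coeffs: "f 0 = 0 \<Longrightarrow> lookup (map_coeffs f Q) m = f (lookup Q m)"
  by (simp add: map.rep_eq when_def)

lemma map_coeffs_0: "f 0 = 0 \<Longrightarrow> map_coeffs f 0 = 0"
  by (rule poly_mapping_eqI) (simp add: lookup_map_coeffs)

lemma map_coeffs_add:
  "is_hom f \<Longrightarrow> map_coeffs f (P + Q) = map_coeffs f P + map_coeffs f Q"
  by (rule poly_mapping_eqI) (simp add: lookup_map_coeffs is_homD lookup_add)

lemma map_coeffs_mult:
  assumes f: "is_hom f"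
  shows "map_coeffs f (P * Q) = map_coeffs f P * map_coeffs f Q"
proof (induction P rule: poly_mapping_single_induct)
  case (single m)
  show ?case
  proof (induction Q rule: poly_mapping_single_induct)
    case (single m')
    show ?case by (simp add: mult_single is_homD[OF f])
  qed (simp_all add: f map_coeffs_0 map_coeffs_add distrib_left is_homD)
qed (simp_all add: f map_coeffs_0 map_coeffs_add distrib_right is_homD)

lemma map_coeffs_bounded:
  assumes "Q \<in> bounded_polys V e" "f 0 = 0"
  shows "map_coeffs f Q \<in> bounded_polys V e"
  using assms by (auto simp: bounded_polys_def in_keys_iff lookup_map_coeffs)

text \<open>The value \<open>c\<close> of \<open>x\<close> may lie in an extension of the
  coefficient field; the other variables remain.\<close>

definition specialize :: "('a::comm_ring_1 \<Rightarrow> 'b::comm_ring_1) \<Rightarrow> nat \<Rightarrow> 'b \<Rightarrow> 'a mpoly \<Rightarrow> 'b mpoly" where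
  "specialize f x c p = map_coeffs (poly_eval f c) (split_var x p)"

lemma specialize_bounded:
  assumes "is_hom f" "p \<in> bounded_polys (insert x V) e"
  shows "specialize f x c p \<in> bounded_polys V e"
  unfolding specialize_def
  by (intro map_coeffs_bounded joint_boundedD(1) split_var_bounded assms(2))
     (simp add: is_homD[OF is_hom_poly_eval[OF assms(1)]])

lemma eval_specialize:
  assumes f: "is_hom f"
  shows "eval_mpoly (\<lambda>x. x) a (specialize f x c p) = eval_mpoly f (a(x := c)) p"
proof (rule additive_eqI[where f = "\<lambda>p. eval_mpoly (\<lambda>x. x) a (specialize f x c p)"])
  note pe = is_homD[OF is_hom_poly_eval[OF f]]
  fix m :: "nat \<Rightarrow>\<^sub>0 nat" and b :: 'a
  let ?m = "m - single x (lookup m x)"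
  have "mon_eval a ?m = mon_eval (a(x := c)) ?m"
    by (rule mon_eval_cong) (auto simp: keys_mon_split)
  then have "mon_eval (a(x := c)) (?m + single x (lookup m x)) = mon_eval a ?m * c ^ lookup m x"
    by (simp add: mon_eval_add)
  then have *: "mon_eval (a(x := c)) m = mon_eval a ?m * c ^ lookup m x"
    using mon_split[of m x] by simp
  have "specialize f x c (single m b) = single ?m (f b * c ^ lookup m x)"
    by (simp add: specialize_def split_var_single pe poly_eval_monom f)
  then show "eval_mpoly (\<lambda>x. x) a (specialize f x c (single m b))
      = eval_mpoly f (a(x := c)) (single m b)"
    by (simp add: eval_mpoly_single is_hom_id f * mult_ac)
qed (simp_all add: specialize_def map_coeffs_0 map_coeffs_add split_var_add eval_mpoly_add f
       is_hom_id is_hom_poly_eval is_homD[OF is_hom_poly_eval[OF f]])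

text \<open>Division by \<open>x - c\<close>, term by term and without raising the degree. It serves
  to lift combinations of specialized generators back to the generators.\<close>

lemma specialize_cong_mod:
  fixes p :: "'a::field mpoly"
  assumes "p \<in> bounded_polys (insert x V) e"
  shows "\<exists>q\<in>bounded_polys (insert x V) e. p = specialize (\<lambda>x. x) x c p + (Var x - Const c) * q"
  using assms
proof (induction p rule: bounded_polys_induct)
  case zero
  then show ?case
    by (intro bexI[of _ 0]) (simp_all add: specialize_def map_coeffs_0 is_homD[OF is_hom_poly_eval[OF is_hom_id]])
next
  case (single m a)
  let ?m = "m - single x (lookup m x)" and ?k = "lookup m x"
  have sp: "specialize (\<lambda>x. x) x c (single m a) = single ?m (a * c ^ ?k)"
    by (simp add: specialize_def split_var_single poly_eval_monom is_hom_id
        is_homD[OF is_hom_poly_eval[OF is_hom_id]])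
  \<comment> \<open>Factor theorem: the difference vanishes at \<open>c\<close>.\<close>
  have "[:-c, 1:] dvd monom a ?k - [:a * c ^ ?k:]"
    by (simp add: poly_eq_0_iff_dvd[symmetric] poly_monom)
  then obtain s where s: "monom a ?k - [:a * c ^ ?k:] = [:-c, 1:] * s" by (elim dvdE)
  have ds: "degree s \<le> ?k"
  proof (cases "s = 0")
    case False
    have "degree ([:-c, 1:] * s) = 1 + degree s"
      using False by (subst degree_mult_eq) auto
    moreover have "degree (monom a ?k - [:a * c ^ ?k:]) \<le> ?k"
      by (intro degree_diff_le degree_monom_le) simp
    ultimately show ?thesis using s by simp
  qed simp
  have "[:-c, 1:] = [:0, 1:] - [:c:]" by simp
  then have "poly_eval Const (Var x) [:-c, 1:] = Var x - Const c"
    by (simp only: is_hom_diff[OF is_hom_poly_eval[OF is_hom_Const]] poly_eval_X poly_eval_const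
        is_hom_Const)
  then have "Const a * Var x ^ ?k - Const (a * c ^ ?k)
      = (Var x - Const c) * poly_eval Const (Var x) s"
    using arg_cong[OF s, of "poly_eval Const (Var x)"]
    by (simp only: is_hom_diff[OF is_hom_poly_eval[OF is_hom_Const]] poly_eval_monom poly_eval_const
        is_hom_Const is_homD(3)[OF is_hom_poly_eval[OF is_hom_Const]])
  then have "(Const a * Var x ^ ?k - Const (a * c ^ ?k)) * single ?m 1
      = (Var x - Const c) * (poly_eval Const (Var x) s * single ?m 1)"
    by (simp only: mult.assoc)
  moreover have "Const a * Var x ^ ?k * single ?m 1 = single m a"
    using mon_split[of m x] by (simp add: Var_power mult_single add.commute)
  moreover have "Const (a * c ^ ?k) * single ?m 1 = specialize (\<lambda>x. x) x c (single m a)"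
    by (simp add: sp mult_single)
  ultimately have "single m a - specialize (\<lambda>x. x) x c (single m a)
      = (Var x - Const c) * (poly_eval Const (Var x) s * single ?m 1)"
    by (simp only: left_diff_distrib)
  then have "single m a = specialize (\<lambda>x. x) x c (single m a)
      + (Var x - Const c) * (poly_eval Const (Var x) s * single ?m 1)"
    by (simp only: diff_eq_eq add.commute)
  moreover have "poly_eval Const (Var x) s * single ?m 1
      \<in> bounded_polys (insert x V) (degree s + mon_degree ?m)"
    using single keys_mon_split[of m x]
    by (intro bounded_polys_mult poly_eval_bounded bounded_polys_single) auto
  moreover have "degree s + mon_degree ?m \<le> e"
    using single(2) ds mon_degree_split[of m x] by simp
  ultimately show ?case using bounded_polys_mono by blast
next
  case (add q r)
  then obtain q' r' where q': "q' \<in> bounded_polys (insert x V) e"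
      "q = specialize (\<lambda>x. x) x c q + (Var x - Const c) * q'"
    and r': "r' \<in> bounded_polys (insert x V) e"
      "r = specialize (\<lambda>x. x) x c r + (Var x - Const c) * r'" by blast
  have "specialize (\<lambda>x. x) x c (q + r)
      = specialize (\<lambda>x. x) x c q + specialize (\<lambda>x. x) x c r"
    by (simp add: specialize_def split_var_add map_coeffs_add is_hom_poly_eval is_hom_id)
  moreover have "s + t * q' + (s' + t * r') = s + s' + t * (q' + r')" for s s' t :: "'a mpoly"
    by (simp add: algebra_simps)
  ultimately have "q + r = specialize (\<lambda>x. x) x c (q + r) + (Var x - Const c) * (q' + r')"
    using arg_cong2[OF q'(2) r'(2), of "(+)"] by (simp only:)
  then show ?case using bounded_polys_add[OF q'(1) r'(1)] by blast
qed

section \<open>Combinations of generators with cofactors of bounded degree\<close>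

section \<open>Multiples of bounded degree\<close>

text \<open>The bound \<open>e\<close> concerns the cofactors \<open>h\<close>, not the products.
  The inductive form lets statements about combinations be proved one summand at a time, without
  naming families of cofactors.\<close>

inductive_set multiples :: "nat set \<Rightarrow> nat \<Rightarrow> 'a::comm_ring_1 mpoly set \<Rightarrow> 'a mpoly set"
  for V e G where
  zero: "0 \<in> multiples V e G"
| step: "u \<in> multiples V e G \<Longrightarrow> h \<in> bounded_polys V e \<Longrightarrow> g \<in> G \<Longrightarrow> u + h * g \<in> multiples V e G"

lemma multiples_mult_generator:
  "h \<in> bounded_polys V e \<Longrightarrow> g \<in> G \<Longrightarrow> h * g \<in> multiples V e G"
  using multiples.step[OF multiples.zero] by simp

lemma multiples_add:
  assumes "u \<in> multiples V e G" "v \<in> multiples V e G"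
  shows "u + v \<in> multiples V e G"
  using assms(2)
proof induction
  case zero
  show ?case using assms(1) by simp
next
  case (step v h g)
  then show ?case using multiples.step[of "u + v" V e G h g] by (simp add: add.assoc)
qed

lemma multiples_sum:
  "(\<And>i. i \<in> A \<Longrightarrow> f i \<in> multiples V e G) \<Longrightarrow> (\<Sum>i\<in>A. f i) \<in> multiples V e G"
  by (induction A rule: infinite_finite_induct) (auto intro: multiples_add multiples.zero)

lemma multiples_mono:
  assumes "u \<in> multiples V e G" "V \<subseteq> V'" "e \<le> e'"
  shows "u \<in> multiples V' e' G"
  using assms(1)
  by induction (auto intro: multiples.intros bounded_polys_mono[OF _ assms(2,3)])

lemma multiples_mult:
  assumes "u \<in> multiples V e G" "q \<in> bounded_polys V e'"
  shows "q * u \<in> multiples V (e + e') G"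
  using assms(1)
proof induction
  case zero
  show ?case by (simp add: multiples.zero)
next
  case (step u h g)
  have "q * h \<in> bounded_polys V (e + e')"
    using bounded_polys_mult[OF step.hyps(2) assms(2)] by (simp add: mult.commute)
  then show ?case
    using multiples.step[OF step.IH, of "q * h" g] step.hyps by (simp add: algebra_simps)
qed

text \<open>Each exponent is at most the total degree, so the exponent vectors lie in a box of side
  \<open>e + 1\<close>.\<close>

lemma finite_bounded_monomials:
  assumes "finite Y"
  shows "finite {m. mkeys m \<subseteq> Y \<and> mon_degree m \<le> e}" (is "finite ?S")
    and "card {m. mkeys m \<subseteq> Y \<and> mon_degree m \<le> e} \<le> (e + 1) ^ card Y"
proof -
  let ?r = "\<lambda>m. restrict (lookup m) Y"
  have inj: "inj_on ?r ?S"
  proof (rule inj_onI, rule poly_mapping_eqI)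
    fix a b i assume a: "a \<in> ?S" and b: "b \<in> ?S" and eq: "?r a = ?r b"
    show "lookup a i = lookup b i"
    proof (cases "i \<in> Y")
      case True
      then show ?thesis using fun_cong[OF eq, of i] by simp
    next
      case False
      then have "i \<notin> mkeys a" "i \<notin> mkeys b" using a b by auto
      then show ?thesis by (simp add: in_keys_iff)
    qed
  qed
  have sub: "?r ` ?S \<subseteq> PiE Y (\<lambda>_. {..e})"
  proof
    fix f assume "f \<in> ?r ` ?S"
    then obtain m where m: "f = ?r m" "mkeys m \<subseteq> Y" "mon_degree m \<le> e" by blast
    have "lookup m i \<le> e" if "i \<in> Y" for i
    proof -
      have "lookup m i \<le> (\<Sum>i\<in>Y. lookup m i)" using assms that by (intro member_le_sum) auto
      then show ?thesis using m assms mon_degree_superset[of Y m] by simp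
    qed
    then show "f \<in> PiE Y (\<lambda>_. {..e})" using m(1) by auto
  qed
  have fin: "finite (PiE Y (\<lambda>_. {..e}))" using assms by (intro finite_PiE) auto
  show "finite ?S" using inj_on_finite[OF inj sub fin] .
  have "card ?S \<le> card (PiE Y (\<lambda>_. {..e}))" by (rule card_inj_on_le[OF inj sub fin])
  then show "card ?S \<le> (e + 1) ^ card Y" using assms by (simp add: card_PiE)
qed

lemma degree_lookup_single_mult:
  fixes Q :: "'a::comm_ring_1 poly mpoly"
  assumes "\<And>\<mu>. degree (lookup Q \<mu>) \<le> d"
  shows "degree (lookup (single m 1 * Q) \<mu>) \<le> d"
proof (induction Q arbitrary: \<mu> rule: poly_mapping_single_induct)
  case (single m')
  show ?case using assms[of m'] by (simp add: mult_single lookup_single when_def)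
qed (simp_all add: distrib_left lookup_add degree_add_le)

lemma field_hom_eq_0_iff:
  fixes f :: "'k::field \<Rightarrow> 'l::field"
  assumes "is_hom f"
  shows "f a = 0 \<longleftrightarrow> a = 0"
proof
  assume "f a = 0"
  then have "f (a * inverse a) = 0" using is_homD(3)[OF assms, of a "inverse a"] by simp
  then show "a = 0" using is_homD(1)[OF assms] by (cases "a = 0") auto
qed (simp add: is_homD[OF assms])

text \<open>For \<open>w \<noteq> 0\<close> the polynomial \<open>1 + x w\<close> has positive
  degree, also after applying the injective \<open>f\<close>. At a root \<open>c\<close>,
  \<open>c * w(c) = -1\<close> excludes \<open>w(c) = 0\<close>.\<close>

lemma root_avoiding:
  fixes f :: "'k::field \<Rightarrow> 'l::alg_closed_field"
  assumes f: "is_hom f" and "w \<noteq> 0"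
  obtains c where "poly_eval f c (1 + [:0, 1:] * w) = 0" "poly_eval f c w \<noteq> 0"
proof -
  have "degree (1 + [:0, 1:] * w) = Suc (degree w)"
    using \<open>w \<noteq> 0\<close> by (simp add: degree_add_eq_right)
  moreover have "degree (map_poly f (1 + [:0, 1:] * w)) = degree (1 + [:0, 1:] * w)"
    by (rule degree_map_poly) (simp add: field_hom_eq_0_iff[OF f])
  ultimately obtain c where c: "poly_eval f c (1 + [:0, 1:] * w) = 0"
    unfolding poly_eval_def using alg_closed_imp_poly_has_root by (metis zero_less_Suc)
  note pe = is_homD[OF is_hom_poly_eval[OF f]]
  have "1 + c * poly_eval f c w = 0"
    using c by (simp only: pe poly_eval_X[OF f])
  then have "poly_eval f c w \<noteq> 0" by auto
  with c that show ?thesis by blast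
qed

section \<open>A univariate combination of the generators\<close>

section \<open>Elimination\<close>

text \<open>The dichotomy of the overview, in a form that fits both uses: \<open>f\<close> is the
  identity in the induction for the Nullstellensatz and the embedding into the algebraic closure for
  the given ideal. Certificates are demanded only at roots of \<open>1 + x w\<close>, because only
  there does maximality up to a bound provide them.\<close>

proposition elimination:
  fixes f :: "'k::field \<Rightarrow> 'l::alg_closed_field" and G :: "'k mpoly set"
  assumes f: "is_hom f" and Y: "finite Y" and G: "G \<subseteq> bounded_polys (insert x Y) d"
    and R: "R = (N + d + 1) ^ card Y"
    and cert: "\<And>w c. w \<noteq> 0 \<Longrightarrow> degree w \<le> (R - 1) * d \<Longrightarrow> poly_eval f c (1 + [:0, 1:] * w) = 0 \<Longrightarrow>
                 1 \<in> multiples Y N (specialize f x c ` G)"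
  shows "\<exists>h. h \<noteq> 0 \<and> degree h \<le> R * d
           \<and> poly_eval Const (Var x) h \<in> multiples (insert x Y) (N + R * d) G"
proof -
  \<comment> \<open>The rows of the system: a monomial of degree at most \<open>N\<close> times a
    separated generator has its support in \<open>S\<close>. The columns, indexed by
    \<open>J\<close>, are these products.\<close>
  define S where "S = {m :: nat \<Rightarrow>\<^sub>0 nat. mkeys m \<subseteq> Y \<and> mon_degree m \<le> N + d}"
  have S: "finite S" "card S \<le> R"
    using finite_bounded_monomials[OF Y, of "N + d"] unfolding S_def R by simp_all
  have S0: "0 \<in> S" by (simp add: S_def)
  define J where "J = {m :: nat \<Rightarrow>\<^sub>0 nat. mkeys m \<subseteq> Y \<and> mon_degree m \<le> N} \<times> G"
  define P where "P = (\<lambda>(m, g). single m 1 * split_var x g :: 'k poly mpoly)"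
  have jb: "split_var x g \<in> joint_bounded Y d" if "g \<in> G" for g
    using split_var_bounded G that by blast
  have deg: "\<forall>j\<in>J. \<forall>\<mu>\<in>S. degree (lookup (P j) \<mu>) \<le> d"
    using joint_boundedD(2)[OF jb] unfolding P_def J_def
    by (auto intro!: degree_lookup_single_mult)
  have supp: "lookup (P j) \<mu> = 0" if "j \<in> J" "\<mu> \<notin> S" for j \<mu>
  proof -
    obtain m g where j: "j = (m, g)" "mkeys m \<subseteq> Y" "mon_degree m \<le> N" "g \<in> G"
      using \<open>j \<in> J\<close> unfolding J_def by blast
    have "P j \<in> bounded_polys Y (N + d)"
      unfolding P_def j(1) prod.case
      by (intro bounded_polys_mult bounded_polys_single joint_boundedD(1)[OF jb] j)
    then show ?thesis using \<open>\<mu> \<notin> S\<close> unfolding bounded_polys_def S_def by (auto simp: in_keys_iff)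
  qed
  have "card S * d \<le> R * d" "(card S - 1) * d \<le> (R - 1) * d"
    using S(2) by (intro mult_right_mono; simp)+
  note cS = order_trans[OF _ this(1)] order_trans[OF _ this(2)]
  consider (rel) h F y where "h \<noteq> 0" "degree h \<le> card S * d" "finite F" "F \<subseteq> J"
      "\<forall>j. degree (y j) \<le> card S * d"
      "\<forall>\<mu>\<in>S. (\<Sum>j\<in>F. lookup (P j) \<mu> * y j) = (if \<mu> = 0 then h else 0)"
    | (orth) w where "w 0 \<noteq> 0" "\<forall>\<mu>. degree (w \<mu>) \<le> (card S - 1) * d"
        "\<forall>j\<in>J. (\<Sum>\<mu>\<in>S. lookup (P j) \<mu> * w \<mu>) = 0"
    using poly_fredholm_alternative[OF S(1) S0 deg] by (elim disjE exE conjE) (rule that, assumption+)+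
  then show ?thesis
  proof cases
    case rel
    have eq: "(\<Sum>j\<in>F. Const (y j) * P j) = Const h"
    proof (rule poly_mapping_eqI)
      fix \<mu>
      have "lookup (\<Sum>j\<in>F. Const (y j) * P j) \<mu> = (\<Sum>j\<in>F. lookup (P j) \<mu> * y j)"
        unfolding lookup_sum lookup_Const_mult by (simp add: mult.commute)
      also have "\<dots> = (if \<mu> = 0 then h else 0)"
      proof (cases "\<mu> \<in> S")
        case True
        then show ?thesis by (rule bspec[OF rel(6)])
      next
        case False
        then have "\<mu> \<noteq> 0" using S0 by blast
        moreover have "(\<Sum>j\<in>F. lookup (P j) \<mu> * y j) = 0"
          using supp[OF subsetD[OF rel(4)] False] by (intro sum.neutral) simp
        ultimately show ?thesis by simp
      qed
      finally show "lookup (\<Sum>j\<in>F. Const (y j) * P j) \<mu> = lookup (Const h) \<mu>"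
        by (simp add: lookup_single when_def)
    qed
    \<comment> \<open>Back in the original ring the cofactor of \<open>g\<close> is
      \<open>y j\<close> times a monomial, of degree at most \<open>R * d\<close> and
      \<open>N\<close> respectively.\<close>
    have "join_var x (Const (y j) * P j) \<in> multiples (insert x Y) (N + R * d) G"
      if "j \<in> F" for j
    proof -
      obtain m g where j: "j = (m, g)" "mkeys m \<subseteq> Y" "mon_degree m \<le> N" "g \<in> G"
        using subsetD[OF rel(4) \<open>j \<in> F\<close>] unfolding J_def by blast
      have "join_var x (Const (y j)) \<in> bounded_polys (insert x Y) (R * d)"
        using poly_eval_bounded[of x "insert x Y" "y j" "R * d"] cS(1)[OF spec[OF rel(5)], of j]
        by (simp add: join_var_single)
      moreover have "join_var x (single m 1) = single m 1"
        by (simp add: join_var_single is_homD[OF is_hom_poly_eval[OF is_hom_Const]])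
      moreover have "single m 1 \<in> bounded_polys (insert x Y) N"
        using j by (intro bounded_polys_single) auto
      ultimately have "join_var x (Const (y j)) * join_var x (single m 1)
          \<in> bounded_polys (insert x Y) (N + R * d)"
        using bounded_polys_mult[of _ "insert x Y" "R * d" _ N] by (metis add.commute)
      moreover have "join_var x (Const (y j) * P j)
          = join_var x (Const (y j)) * join_var x (single m 1) * g"
        by (simp add: P_def j(1) is_homD(3)[OF is_hom_join_var] join_split_var mult.assoc)
      ultimately show ?thesis using multiples_mult_generator j(4) by metis
    qed
    then have "join_var x (\<Sum>j\<in>F. Const (y j) * P j) \<in> multiples (insert x Y) (N + R * d) G"
      unfolding is_hom_sum[OF is_hom_join_var] by (rule multiples_sum)
    then have "poly_eval Const (Var x) h \<in> multiples (insert x Y) (N + R * d) G"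
      unfolding eq join_var_single by simp
    then show ?thesis using rel(1) cS(1)[OF rel(2)] by blast
  next
    case orth
    obtain c where c: "poly_eval f c (1 + [:0, 1:] * w 0) = 0" "poly_eval f c (w 0) \<noteq> 0"
      using root_avoiding[OF f orth(1)] .
    \<comment> \<open>The vector \<open>w\<close>, evaluated at \<open>c\<close>, as a linear
      functional on coefficients. It kills every combination of the specialized generators with
      cofactors of degree at most \<open>N\<close>, but takes the value \<open>w 0\<close> at
      \<open>c\<close>, which is nonzero, on the polynomial \<open>1\<close>.\<close>
    define \<psi> where "\<psi> p = (\<Sum>\<mu>\<in>S. poly_eval f c (w \<mu>) * lookup p \<mu>)" for p :: "'l mpoly"
    have \<psi>_add: "\<psi> (p + q) = \<psi> p + \<psi> q" for p q
      by (simp add: \<psi>_def lookup_add distrib_left sum.distrib)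
    have \<psi>_0: "\<psi> 0 = 0" by (simp add: \<psi>_def)
    note hom = is_hom_poly_eval[OF f, of c]
    have gen: "\<psi> (q * specialize f x c g) = 0" if "q \<in> bounded_polys Y N" "g \<in> G" for q g
      using that(1)
    proof (induction q rule: bounded_polys_induct)
      case (single m a)
      have "(m, g) \<in> J" using single that(2) by (simp add: J_def)
      have "single m a * specialize f x c g
          = Const a * map_coeffs (poly_eval f c) (P (m, g))"
        by (simp add: specialize_def P_def map_coeffs_mult[OF hom] is_homD[OF hom]
            mult_single mult.assoc[symmetric])
      then have "\<psi> (single m a * specialize f x c g)
          = a * (\<Sum>\<mu>\<in>S. poly_eval f c (w \<mu>) * poly_eval f c (lookup (P (m, g)) \<mu>))"
        by (simp add: \<psi>_def lookup_Const_mult lookup_map_coeffs is_homD[OF hom] sum_distrib_left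
            mult_ac)
      also have "\<dots> = a * poly_eval f c (\<Sum>\<mu>\<in>S. lookup (P (m, g)) \<mu> * w \<mu>)"
        by (simp add: is_hom_sum[OF hom] is_homD(3)[OF hom] mult.commute)
      also have "\<dots> = 0" using orth(3) \<open>(m, g) \<in> J\<close> by (simp add: is_homD[OF hom])
      finally show ?case .
    qed (simp_all add: \<psi>_add \<psi>_0 distrib_right)
    have "\<psi> u = 0" if "u \<in> multiples Y N (specialize f x c ` G)" for u
      using that by induction (auto simp: \<psi>_0 \<psi>_add gen)
    then have "\<psi> 1 = 0" using cert[OF orth(1) cS(2)[OF spec[OF orth(2)]] c(1)] by blast
    moreover have "\<psi> 1 = (\<Sum>\<mu>\<in>S. if \<mu> = 0 then poly_eval f c (w 0) else 0)"
      unfolding \<psi>_def by (intro sum.cong) (auto simp: lookup_one)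
    ultimately show ?thesis using c(2) S S0 by simp
  qed
qed

section \<open>Bounded certificates for systems without common zeros\<close>

section \<open>An effective Nullstellensatz\<close>

text \<open>With \<open>N\<close> the value at \<open>n\<close> and
  \<open>R = (N + d + 1) ^ n\<close>, the next value is \<open>N + R * d * (N + d + 1)\<close>:
  \<open>R * d\<close> bounds the degree of the univariate \<open>h\<close> from
  \<open>elimination\<close>, and each root of \<open>h\<close> costs \<open>N + d + 1\<close> in
  \<open>unit_mod_univariate\<close>.\<close>

fun cert_degree :: "nat \<Rightarrow> nat \<Rightarrow> nat" where
  "cert_degree d 0 = 0"
| "cert_degree d (Suc n) =
     cert_degree d n + (cert_degree d n + d + 1) ^ n * d * (cert_degree d n + d + 1)"

text \<open>Each specialized generator is \<open>g - (x - c) * r\<close> with \<open>r\<close> of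
  degree at most \<open>d\<close>; the terms \<open>h * r\<close> are collected in
  \<open>q\<close>.\<close>

lemma specialize_multiples:
  fixes G :: "'a::field mpoly set"
  assumes "G \<subseteq> bounded_polys (insert x V) d"
    and "v \<in> multiples V N (specialize (\<lambda>x. x) x c ` G)"
  shows "\<exists>u q. u \<in> multiples (insert x V) N G \<and> q \<in> bounded_polys (insert x V) (N + d)
           \<and> v = u + (Var x - Const c) * q"
  using assms(2)
proof induction
  case zero
  show ?case by (intro exI[of _ 0]) (simp add: multiples.zero)
next
  case (step v h g')
  then obtain g where g: "g \<in> G" "g' = specialize (\<lambda>x. x) x c g" by blast
  obtain r where r: "r \<in> bounded_polys (insert x V) d"
      "g = specialize (\<lambda>x. x) x c g + (Var x - Const c) * r"
    using specialize_cong_mod assms(1) g(1) by blast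
  obtain u q where uq: "u \<in> multiples (insert x V) N G" "q \<in> bounded_polys (insert x V) (N + d)"
      "v = u + (Var x - Const c) * q"
    using step.IH by blast
  have h: "h \<in> bounded_polys (insert x V) N"
    using bounded_polys_mono[OF step.hyps(2)] by blast
  have g': "g' = g - (Var x - Const c) * r" using r(2) g(2) by (simp only: eq_diff_eq)
  have "v + h * g' = (u + h * g) + (Var x - Const c) * (q - h * r)"
    unfolding uq(3) g' by (simp add: algebra_simps)
  moreover have "u + h * g \<in> multiples (insert x V) N G"
    by (rule multiples.step[OF uq(1) h g(1)])
  moreover have "q - h * r \<in> bounded_polys (insert x V) (N + d)"
    by (intro bounded_polys_diff uq bounded_polys_mult h r)
  ultimately show ?case by blast
qed

text \<open>Multiplying the congruences \<open>1 \<equiv> (x - c) q\<^sub>c\<close> modulo the generators over all roots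
  \<open>c\<close> of \<open>h\<close>.\<close>

lemma unit_mod_univariate:
  fixes G :: "'a::alg_closed_field mpoly set"
  assumes G: "G \<subseteq> bounded_polys (insert x V) d"
    and cert: "\<And>c. 1 \<in> multiples V N (specialize (\<lambda>x. x) x c ` G)"
    and "h \<noteq> 0"
  shows "\<exists>u q. u \<in> multiples (insert x V) (N + degree h * (N + d + 1)) G
           \<and> q \<in> bounded_polys (insert x V) (degree h * (N + d))
           \<and> 1 = u + poly_eval Const (Var x) h * q"
  using \<open>h \<noteq> 0\<close>
proof (induction "degree h" arbitrary: h)
  case 0
  then obtain a where a: "h = [:a:]" by (metis degree_eq_zeroE)
  with 0 have "a \<noteq> 0" by simp
  then have "poly_eval Const (Var x) h * Const (1 / a) = 1"
    by (simp add: a poly_eval_const is_hom_Const mult_single)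
  moreover have "Const (1 / a) \<in> bounded_polys (insert x V) (degree h * (N + d))"
    by (rule bounded_polys_single) simp_all
  ultimately show ?case by (intro exI[of _ 0] exI[of _ "Const (1 / a)"]) (simp add: multiples.zero)
next
  case (Suc n)
  let ?V = "insert x V"
  obtain c where "poly h c = 0"
    using alg_closed_imp_poly_has_root[of h] Suc.hyps(2) by auto
  then obtain h' where h': "h = [:-c, 1:] * h'" by (metis poly_eq_0_iff_dvd dvdE)
  with Suc.prems have "h' \<noteq> 0" by auto
  then have deg: "degree h = Suc (degree h')" unfolding h' by (subst degree_mult_eq) auto
  then have n: "n = degree h'" using Suc.hyps(2) by simp
  note pe = is_hom_poly_eval[OF is_hom_Const, where c = "Var x"]
  obtain u q where uq: "u \<in> multiples ?V (N + n * (N + d + 1)) G"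
      "q \<in> bounded_polys ?V (n * (N + d))" "1 = u + poly_eval Const (Var x) h' * q"
    using Suc.hyps(1)[OF n \<open>h' \<noteq> 0\<close>] unfolding n by blast
  obtain v r where vr: "v \<in> multiples ?V N G" "r \<in> bounded_polys ?V (N + d)"
      "1 = v + (Var x - Const c) * r"
    using specialize_multiples[OF G cert] by blast
  have "[:-c, 1:] = [:0, 1:] - [:c:]" by simp
  then have "poly_eval Const (Var x) [:-c, 1:] = Var x - Const c"
    by (simp only: is_hom_diff[OF pe] poly_eval_X poly_eval_const is_hom_Const)
  then have h: "poly_eval Const (Var x) h = (Var x - Const c) * poly_eval Const (Var x) h'"
    by (simp only: h' is_homD(3)[OF pe])
  let ?t = "poly_eval Const (Var x) h' * q"
  \<comment> \<open>The relation for the new root replaces a factor \<open>1\<close> next to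
    \<open>?t\<close>.\<close>
  have "1 = u + ?t * (v + (Var x - Const c) * r)" using uq(3) vr(3) by simp
  also have "\<dots> = (u + ?t * v) + poly_eval Const (Var x) h * (q * r)"
    unfolding h by (simp add: algebra_simps)
  finally have "1 = (u + ?t * v) + poly_eval Const (Var x) h * (q * r)" .
  moreover have "u + ?t * v \<in> multiples ?V (N + degree h * (N + d + 1)) G"
  proof (rule multiples_add)
    show "u \<in> multiples ?V (N + degree h * (N + d + 1)) G"
      by (rule multiples_mono[OF uq(1)]) (simp_all add: deg n)
    \<comment> \<open>The summand \<open>n\<close> comes from \<open>h'\<close> and
      \<open>n * (N + d)\<close> from \<open>q\<close>.\<close>
    have "?t \<in> bounded_polys ?V (n + n * (N + d))"
      by (intro bounded_polys_mult poly_eval_bounded uq(2)) (simp_all add: n)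
    from multiples_mult[OF vr(1) this]
    show "?t * v \<in> multiples ?V (N + degree h * (N + d + 1)) G"
      by (rule multiples_mono) (simp_all add: deg n)
  qed
  moreover have "q * r \<in> bounded_polys ?V (degree h * (N + d))"
    by (rule bounded_polys_mono[OF bounded_polys_mult[OF uq(2) vr(2)]]) (simp_all add: deg n)
  ultimately show ?case by blast
qed

text \<open>Induction on the variables. The hypothesis of induction applies at every
  \<open>x = c\<close>, so \<open>elimination\<close> puts some \<open>h(x)\<close> among the
  bounded combinations and \<open>unit_mod_univariate\<close> gives \<open>1 = u + h q\<close>.
  Without variables, a generator that does not vanish is a nonzero constant.\<close>

theorem effective_nullstellensatz:
  fixes G :: "'a::alg_closed_field mpoly set"
  assumes "finite V" "G \<subseteq> bounded_polys V d"
    and "\<And>a. \<exists>g\<in>G. eval_mpoly (\<lambda>x. x) a g \<noteq> 0"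
  shows "1 \<in> multiples V (cert_degree d (card V)) G"
  using assms
proof (induction V arbitrary: G rule: finite_induct)
  case empty
  obtain g where g: "g \<in> G" "eval_mpoly (\<lambda>x. x) (\<lambda>_. 0) g \<noteq> 0" using empty.prems(2) by blast
  have "mkeys g \<subseteq> {0}" using g(1) empty.prems(1) unfolding bounded_polys_def by auto
  then have "lookup g m = 0" if "m \<noteq> 0" for m using that by (auto simp: in_keys_iff)
  then have gc: "g = Const (lookup g 0)"
    by (intro poly_mapping_eqI) (auto simp: lookup_single when_def)
  have "g \<noteq> 0" using g(2) by auto
  then have "lookup g 0 \<noteq> 0" using gc by (metis single_zero)
  then have "Const (1 / lookup g 0) * Const (lookup g 0) = 1" by (simp add: mult_single)
  then have "Const (1 / lookup g 0) * g = 1" using gc by simp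
  moreover have "Const (1 / lookup g 0) \<in> bounded_polys {} 0"
    by (rule bounded_polys_single) simp_all
  ultimately show ?case using multiples_mult_generator[of _ "{}" 0 g G] g(1) by (metis card.empty cert_degree.simps(1))
next
  case (insert x V)
  define N where "N = cert_degree d (card V)"
  define R where "R = (N + d + 1) ^ card V"
  \<comment> \<open>A common zero \<open>a\<close> of the specialized generators would make
    \<open>a(x := c)\<close> a common zero of \<open>G\<close>.\<close>
  have cert: "1 \<in> multiples V N (specialize (\<lambda>x. x) x c ` G)" for c
    unfolding N_def
  proof (rule insert.IH)
    show "specialize (\<lambda>x. x) x c ` G \<subseteq> bounded_polys V d"
      using insert.prems(1) specialize_bounded[OF is_hom_id] by blast
    show "\<exists>g\<in>specialize (\<lambda>x. x) x c ` G. eval_mpoly (\<lambda>x. x) a g \<noteq> 0" for a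
      using insert.prems(2)[of "a(x := c)"] by (simp add: eval_specialize[OF is_hom_id] del: fun_upd_apply)
  qed
  obtain h where h: "h \<noteq> 0" "degree h \<le> R * d"
      "poly_eval Const (Var x) h \<in> multiples (insert x V) (N + R * d) G"
    using elimination[OF is_hom_id insert.hyps(1) insert.prems(1) R_def cert] by blast
  obtain u q where uq: "u \<in> multiples (insert x V) (N + degree h * (N + d + 1)) G"
      "q \<in> bounded_polys (insert x V) (degree h * (N + d))"
      "1 = u + poly_eval Const (Var x) h * q"
    using unit_mod_univariate[OF insert.prems(1) cert h(1)] by blast
  \<comment> \<open>Both summands of \<open>1 = u + h q\<close> fit under \<open>E\<close>. For
    \<open>h q\<close> the degree is at most \<open>N + R * d + R * d * (N + d)\<close>, which
    equals \<open>E\<close>.\<close>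
  define E where "E = cert_degree d (card (insert x V))"
  have E: "E = N + R * d * (N + d + 1)"
    using insert.hyps by (simp add: E_def N_def R_def)
  have "u \<in> multiples (insert x V) E G"
  proof (rule multiples_mono[OF uq(1)])
    show "N + degree h * (N + d + 1) \<le> E" unfolding E by (intro add_left_mono mult_right_mono h(2)) simp
  qed simp
  moreover have "q * poly_eval Const (Var x) h \<in> multiples (insert x V) E G"
  proof (rule multiples_mono[OF multiples_mult[OF h(3) uq(2)]])
    have "degree h * (N + d) \<le> R * d * (N + d)" by (intro mult_right_mono h(2)) simp
    then show "N + R * d + degree h * (N + d) \<le> E" unfolding E by (simp add: algebra_simps)
  qed simp
  ultimately show ?case
    using multiples_add uq(3) unfolding E_def by (metis mult.commute)
qed

section \<open>Univariate elements of an ideal that is maximal up to a bound\<close>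

section \<open>Ideals of the polynomial ring\<close>

lemma bounded_polys_iff:
  "p \<in> bounded_polys {1..n} e \<longleftrightarrow> p \<in> carrier (mpoly_ring n) \<and> total_degree p \<le> e"
  unfolding bounded_polys_def mem_carrier_mpoly_ring total_degree_def mon_degree_def by auto

lemma ideal_mpolyD:
  fixes I :: "'k::field mpoly set"
  assumes "ideal I (mpoly_ring n)"
  shows "I \<subseteq> carrier (mpoly_ring n)" "0 \<in> I"
    and "p \<in> I \<Longrightarrow> q \<in> I \<Longrightarrow> p + q \<in> I"
    and "p \<in> I \<Longrightarrow> r \<in> carrier (mpoly_ring n) \<Longrightarrow> r * p \<in> I"
    and "p \<in> I \<Longrightarrow> - p \<in> I"
    and "p \<in> I \<Longrightarrow> q \<in> I \<Longrightarrow> p - q \<in> I"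
proof -
  interpret ideal I "mpoly_ring n" by fact
  show "I \<subseteq> carrier (mpoly_ring n)" "0 \<in> I"
    using a_subset additive_subgroup.zero_closed[OF is_additive_subgroup] by simp_all
  show add: "p + q \<in> I" if "p \<in> I" "q \<in> I" for p q
    using additive_subgroup.a_closed[OF is_additive_subgroup that] by simp
  show mult: "r * p \<in> I" if "p \<in> I" "r \<in> carrier (mpoly_ring n)" for p r
    using I_l_closed[OF that] by simp
  show uminus: "- p \<in> I" if "p \<in> I" for p
    using mult[OF that, of "- 1"] by (simp add: mpoly_ring_closed)
  show "p - q \<in> I" if "p \<in> I" "q \<in> I"
    using add[OF that(1) uminus[OF that(2)]] by simp
qed

lemma multiples_subset_ideal:
  fixes I :: "'k::field mpoly set"
  assumes I: "ideal I (mpoly_ring n)" and "G \<subseteq> I" and "u \<in> multiples {1..n} e G"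
  shows "u \<in> I"
  using assms(3)
proof induction
  case zero
  show ?case by (rule ideal_mpolyD(2)[OF I])
next
  case (step u h g)
  have "h \<in> carrier (mpoly_ring n)" using step.hyps(2) unfolding bounded_polys_iff by blast
  then have "h * g \<in> I" using step.hyps(3) assms(2) ideal_mpolyD(4)[OF I] by blast
  then show ?case using ideal_mpolyD(3)[OF I] step.IH by blast
qed

lemma ideal_eval_kernel:
  fixes f :: "'k::field \<Rightarrow> 'l::comm_ring_1"
  assumes f: "is_hom f"
  shows "ideal {p \<in> carrier (mpoly_ring n). eval_mpoly f a p = 0} (mpoly_ring n)" (is "ideal ?K ?R")
proof -
  interpret R: cring ?R by (rule cring_mpoly_ring)
  note hom = is_hom_eval_mpoly[OF f]
  have a_inv: "\<ominus>\<^bsub>?R\<^esub> p = - p" if "p \<in> carrier ?R" for p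
    by (rule R.minus_equality) (simp_all add: that mpoly_ring_closed)
  show ?thesis
  proof (rule idealI)
    show "ring ?R" by (rule R.ring_axioms)
    show "subgroup ?K (add_monoid ?R)"
    proof (rule subgroup.intro)
      show "inv\<^bsub>add_monoid ?R\<^esub> p \<in> ?K" if "p \<in> ?K" for p
      proof -
        have "inv\<^bsub>add_monoid ?R\<^esub> p = - p" using a_inv that by (simp add: a_inv_def)
        then show ?thesis using that by (simp add: mpoly_ring_closed is_hom_uminus[OF hom])
      qed
    qed (auto simp: mpoly_ring_closed is_homD[OF hom])
  qed (simp_all add: mpoly_ring_closed is_homD[OF hom])
qed

text \<open>The kernel of an evaluation is an ideal containing \<open>G\<close>, and
  \<open>genideal\<close> is the intersection of all such ideals.\<close>

lemma eval_genideal: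
  fixes f :: "'k::field \<Rightarrow> 'l::comm_ring_1"
  assumes "is_hom f" "G \<subseteq> carrier (mpoly_ring n)" "p \<in> genideal (mpoly_ring n) G"
    and "\<And>g. g \<in> G \<Longrightarrow> eval_mpoly f a g = 0"
  shows "eval_mpoly f a p = 0"
proof -
  have "G \<subseteq> {p \<in> carrier (mpoly_ring n). eval_mpoly f a p = 0}" using assms(2,4) by blast
  then show ?thesis
    using assms(3) ideal_eval_kernel[OF assms(1)] unfolding genideal_def by blast
qed

lemma eval_poly_eval:
  assumes f: "is_hom f"
  shows "eval_mpoly f a (poly_eval Const (Var x) q) = poly_eval f (a x) q"
proof -
  note hom = is_hom_eval_mpoly[OF f, of a]
  have "eval_mpoly f a (poly_eval Const (Var x) (monom b l)) = poly_eval f (a x) (monom b l)" for b l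
    by (simp add: poly_eval_monom is_hom_Const f is_homD[OF hom] is_hom_power[OF hom] Var_def
        eval_mpoly_single is_homD[OF f])
  then have "eval_mpoly f a (poly_eval Const (Var x) (\<Sum>l\<le>degree q. monom (coeff q l) l))
      = poly_eval f (a x) (\<Sum>l\<le>degree q. monom (coeff q l) l)"
    by (simp add: is_hom_sum[OF is_hom_poly_eval[OF is_hom_Const]] is_hom_sum[OF hom]
        is_hom_sum[OF is_hom_poly_eval[OF f]])
  then show ?thesis by (simp only: poly_as_sum_of_monoms)
qed

lemma is_hom_to_ac: "is_hom (to_ac :: 'k::field \<Rightarrow> 'k alg_closure)"
  by (simp add: is_hom_def)

lemma univariate_mem:
  fixes G :: "'k::field mpoly set"
  assumes G: "G \<subseteq> bounded_polys {1..n} d" and I: "I = genideal (mpoly_ring n) G"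
    and max: "maximal_up_to n b I" and x: "x \<in> {1..n}" and "d \<ge> 1"
    and R: "R = (cert_degree d (n - 1) + d + 1) ^ (n - 1)"
    and b: "(R - 1) * d + 1 \<le> b"
  shows "\<exists>h. h \<noteq> 0 \<and> degree h \<le> R * d \<and> poly_eval Const (Var x) h \<in> I"
proof -
  let ?N = "cert_degree d (n - 1)" and ?Y = "{1..n} - {x}"
  have V: "insert x ?Y = {1..n}" and Y: "finite ?Y" "card ?Y = n - 1" using x by auto
  have Gc: "G \<subseteq> carrier (mpoly_ring n)" using G bounded_polys_iff by blast
  note ring = cring.axioms(1)[OF cring_mpoly_ring]
  have ideal: "ideal I (mpoly_ring n)" unfolding I by (rule ring.genideal_ideal[OF ring Gc])
  have GI: "G \<subseteq> I" unfolding I by (rule ring.genideal_self[OF ring Gc])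
  have "R \<ge> 1" unfolding R by simp
  then have Rd: "(R - 1) * d + 1 \<le> R * d" using \<open>d \<ge> 1\<close> by (cases R) auto
  let ?p = "\<lambda>w. poly_eval Const (Var x) (1 + [:0, 1:] * w)"
  have deg: "degree (1 + [:0, 1:] * w) \<le> (R - 1) * d + 1" if "degree w \<le> (R - 1) * d" for w :: "'k poly"
  proof (rule degree_add_le)
    have "degree ([:0, 1:] * w) \<le> degree ([:0, 1:] :: 'k poly) + degree w" by (rule degree_mult_le)
    then show "degree ([:0, 1:] * w) \<le> (R - 1) * d + 1" using that by simp
  qed simp
  show ?thesis
  \<comment> \<open>If some \<open>1 + x w\<close> already lies in \<open>I\<close>, it serves as
    \<open>h\<close>: its constant coefficient 1 makes it nonzero. Otherwise each of them is outside
    \<open>I\<close> and has degree at most \<open>b\<close>, hence is a unit modulo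
    \<open>I\<close>.\<close>
  proof (cases "\<exists>w. degree w \<le> (R - 1) * d \<and> ?p w \<in> I")
    case True
    then obtain w where w: "degree w \<le> (R - 1) * d" "?p w \<in> I" by blast
    have "coeff (1 + [:0, 1:] * w) 0 = 1" by simp
    then have "1 + [:0, 1:] * w \<noteq> 0" by (metis coeff_0 zero_neq_one)
    then show ?thesis using w(2) order_trans[OF deg[OF w(1)] Rd] by blast
  next
    case False
    have "1 \<in> multiples ?Y ?N (specialize to_ac x c ` G)"
      if w: "degree w \<le> (R - 1) * d" and c: "poly_eval to_ac c (1 + [:0, 1:] * w) = 0" for w c
    proof -
      have "?p w \<in> bounded_polys {1..n} b"
        by (rule poly_eval_bounded[OF x order_trans[OF deg[OF w] b]])
      then have "?p w \<in> carrier (mpoly_ring n) - I" "total_degree (?p w) \<le> b"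
        using False w unfolding bounded_polys_iff by blast+
      then obtain q where q: "q \<in> carrier (mpoly_ring n)" "?p w * q - 1 \<in> I"
        using max unfolding maximal_up_to_def by blast
      have "1 \<in> multiples ?Y (cert_degree d (card ?Y)) (specialize to_ac x c ` G)"
      proof (rule effective_nullstellensatz[OF Y(1)])
        show "specialize to_ac x c ` G \<subseteq> bounded_polys ?Y d"
          using G specialize_bounded[OF is_hom_to_ac, of _ x ?Y d c] unfolding V by blast
        fix a
        show "\<exists>g\<in>specialize to_ac x c ` G. eval_mpoly (\<lambda>x. x) a g \<noteq> 0"
        proof (rule ccontr)
          assume "\<not> ?thesis"
          then have zero: "eval_mpoly to_ac (a(x := c)) g = 0" if "g \<in> G" for g
            using that by (auto simp: eval_specialize[OF is_hom_to_ac])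
          note hom = is_hom_eval_mpoly[OF is_hom_to_ac, of "a(x := c)"]
          \<comment> \<open>Since \<open>c\<close> is a root of \<open>1 + x w\<close>, the same
            value is also -1.\<close>
          have "eval_mpoly to_ac (a(x := c)) (?p w * q - 1) = 0"
            by (rule eval_genideal[OF is_hom_to_ac Gc q(2)[unfolded I] zero])
          then show False
            using c by (simp only: is_hom_diff[OF hom] is_homD(1,3)[OF hom]
                eval_poly_eval[OF is_hom_to_ac] fun_upd_same) simp
        qed
      qed
      then show ?thesis unfolding Y(2) .
    qed
    note cert = this
    have G': "G \<subseteq> bounded_polys (insert x ?Y) d" using G unfolding V .
    have R': "R = (?N + d + 1) ^ card ?Y" using R Y(2) by simp
    obtain h where "h \<noteq> 0" "degree h \<le> R * d"
        "poly_eval Const (Var x) h \<in> multiples (insert x ?Y) (?N + R * d) G"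
      using elimination[OF is_hom_to_ac Y(1) G' R'] cert by blast
    then show ?thesis using multiples_subset_ideal[OF ideal GI] unfolding V by blast
  qed
qed

section \<open>The linear case\<close>

lemma mon_degree_le_1:
  assumes "mon_degree m \<le> 1"
  shows "m = 0 \<or> (\<exists>i\<in>mkeys m. m = single i 1)"
proof (cases "m = 0")
  case False
  then obtain i where i: "i \<in> mkeys m" by (metis all_not_in_conv keys_eq_empty)
  let ?m = "m - single i (lookup m i)"
  have "lookup m i \<ge> 1" using i by (simp add: in_keys_iff)
  then have l: "lookup m i = 1" and "mon_degree ?m = 0"
    using mon_degree_split[of m i] assms by linarith+
  then have "\<forall>j\<in>mkeys ?m. lookup ?m j = 0" unfolding mon_degree_def by simp
  then have "mkeys ?m = {}" by (metis all_not_in_conv in_keys_iff)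
  then have "?m = 0" by simp
  then have "m = single i 1" using mon_split[of m i] l by simp
  then show ?thesis using i by blast
qed simp

text \<open>If \<open>Var x\<close> is outside \<open>I\<close>, it is invertible modulo
  \<open>I\<close>, so \<open>G\<close> and \<open>Var x\<close> have no common zero. Linear algebra
  over \<open>k\<close> on the span of 1 and the variables then gives a nonzero constant as a
  combination of \<open>G\<close> and \<open>Var x\<close>; moving the multiple of
  \<open>Var x\<close> to the other side yields \<open>h\<close>.\<close>

lemma linear_univariate_mem:
  fixes G :: "'k::field mpoly set"
  assumes G: "G \<subseteq> bounded_polys {1..n} 1" and I: "I = genideal (mpoly_ring n) G"
    and max: "maximal_up_to n 1 I" and x: "x \<in> {1..n}"
  shows "\<exists>h. h \<noteq> 0 \<and> degree h \<le> 1 \<and> poly_eval Const (Var x) h \<in> I"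
proof (cases "Var x \<in> I")
  case True
  have "poly_eval Const (Var x) [:0, 1:] = (Var x :: 'k mpoly)" by (rule poly_eval_X[OF is_hom_Const])
  then have "poly_eval Const (Var x) [:0, 1:] \<in> I" using True by (simp only:)
  moreover have "[:0, 1:] \<noteq> (0 :: 'k poly)" "degree [:0, 1 :: 'k:] \<le> 1" by simp_all
  ultimately show ?thesis by blast
next
  case False
  have Gc: "G \<subseteq> carrier (mpoly_ring n)" using G bounded_polys_iff by blast
  note ring = cring.axioms(1)[OF cring_mpoly_ring]
  have ideal: "ideal I (mpoly_ring n)" unfolding I by (rule ring.genideal_ideal[OF ring Gc])
  have GI: "G \<subseteq> I" unfolding I by (rule ring.genideal_self[OF ring Gc])
  have Vx: "(Var x :: 'k mpoly) \<in> bounded_polys {1..n} 1" by (rule Var_bounded[OF x])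
  then obtain q where q: "q \<in> carrier (mpoly_ring n)" "Var x * q - 1 \<in> I"
    using max False unfolding maximal_up_to_def bounded_polys_iff by blast
  define S where "S = {m :: nat \<Rightarrow>\<^sub>0 nat. mkeys m \<subseteq> {1..n} \<and> mon_degree m \<le> 1}"
  have S: "finite S" "0 \<in> S"
    using finite_bounded_monomials(1)[of "{1..n}" 1] unfolding S_def by simp_all
  define J where "J = insert (Var x) G"
  have Jb: "g \<in> bounded_polys {1..n} 1" if "g \<in> J" for g
    using that G Vx unfolding J_def by blast
  have supp: "lookup g m = 0" if "g \<in> J" "m \<notin> S" for g m
    using Jb[OF that(1)] that(2) unfolding bounded_polys_def S_def by (auto simp: in_keys_iff)
  \<comment> \<open>Coefficients in \<open>k\<close> are constant polynomials, so the alternative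
    over \<open>k[x]\<close> applies with degree bound 0 and its solutions are constants
    too.\<close>
  have deg: "\<forall>g\<in>J. \<forall>m\<in>S. degree [:lookup g m:] \<le> 0" by simp
  consider (rel) h F y where "h \<noteq> 0" "degree h \<le> card S * 0" "finite F" "F \<subseteq> J"
      "\<forall>j. degree (y j) \<le> card S * 0"
      "\<forall>m\<in>S. (\<Sum>g\<in>F. [:lookup g m:] * y g) = (if m = 0 then h else 0)"
    | (orth) w where "w 0 \<noteq> 0" "\<forall>m. degree (w m) \<le> (card S - 1) * 0"
        "\<forall>g\<in>J. (\<Sum>m\<in>S. [:lookup g m:] * w m) = 0"
    using poly_fredholm_alternative[OF S deg] by (elim disjE exE conjE) (rule that, assumption+)+
  then show ?thesis
  proof cases
    case rel
    define a where "a g = coeff (y g) 0" for g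
    obtain b where b: "h = [:b:]" using rel(2) by (metis degree_eq_zeroE le_zero_eq mult_0_right)
    with rel(1) have "b \<noteq> 0" by simp
    have y: "y g = [:a g:]" for g
      using spec[OF rel(5), of g] unfolding a_def by (metis degree_eq_zeroE le_zero_eq mult_0_right coeff_pCons_0)
    have "(\<Sum>g\<in>F. lookup g m * a g) = (if m = 0 then b else 0)" if "m \<in> S" for m
      using arg_cong[OF bspec[OF rel(6) that], of "\<lambda>p. coeff p 0"]
      by (simp add: coeff_sum y b mult.commute split: if_splits)
    moreover have "(\<Sum>g\<in>F. lookup g m * a g) = 0" if "m \<notin> S" for m
      using supp[OF subsetD[OF rel(4)] that] by (intro sum.neutral) simp
    ultimately have *: "(\<Sum>g\<in>F. lookup g m * a g) = (if m = 0 then b else 0)" for m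
      using S(2) by metis
    have eq: "(\<Sum>g\<in>F. Const (a g) * g) = Const b"
    proof (rule poly_mapping_eqI)
      fix m
      show "lookup (\<Sum>g\<in>F. Const (a g) * g) m = lookup (Const b) m"
        using *[of m] unfolding lookup_sum lookup_Const_mult
        by (simp add: lookup_single when_def mult.commute)
    qed
    have Ca: "Const r \<in> carrier (mpoly_ring n)" for r :: 'k
      by (simp add: mem_carrier_mpoly_ring)
    \<comment> \<open>The coefficient of \<open>Var x\<close>, with 0 if \<open>Var x\<close> does
      not occur; the other summands are multiples of elements of \<open>G\<close> and add up to an
      element of \<open>I\<close>.\<close>
    define z where "z = (if Var x \<in> F then a (Var x) else 0)"
    have "(\<Sum>g\<in>F - {Var x}. Const (a g) * g) \<in> I"
    proof -
      have "(\<Sum>g\<in>A. Const (a g) * g) \<in> I" if "finite A" "A \<subseteq> G" for A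
        using that by (induction A)
          (use GI in \<open>auto intro: ideal_mpolyD(2)[OF ideal] ideal_mpolyD(3)[OF ideal]
             ideal_mpolyD(4)[OF ideal _ Ca]\<close>)
      then show ?thesis using rel(3,4) unfolding J_def by blast
    qed
    moreover have "(\<Sum>g\<in>F. Const (a g) * g) = Const z * Var x + (\<Sum>g\<in>F - {Var x}. Const (a g) * g)"
      using rel(3) by (simp add: z_def sum.remove)
    then have "Const b - Const z * Var x = (\<Sum>g\<in>F - {Var x}. Const (a g) * g)"
      unfolding eq by (simp only: add_diff_cancel_left')
    ultimately have "Const b - Const z * Var x \<in> I" by (simp only:)
    moreover have "poly_eval Const (Var x) [:b, - z:] = Const b - Const z * Var x"
      by (simp add: poly_eval_def map_poly_pCons single_uminus mult.commute)
    ultimately show ?thesis using \<open>b \<noteq> 0\<close>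
      by (intro exI[of _ "[:b, - z:]"]) simp
  next
    case orth
    define v where "v m = coeff (w m) 0" for m
    have w: "w m = [:v m:]" for m
      using spec[OF orth(2), of m] unfolding v_def by (metis degree_eq_zeroE le_zero_eq mult_0_right coeff_pCons_0)
    have v0: "v 0 \<noteq> 0" using orth(1) w by simp
    \<comment> \<open>A functional that is nonzero at the monomial 1 becomes, after normalization,
      evaluation at a point. This works because only monomials of degree at most 1 occur.\<close>
    define a where "a i = v (single i 1) / v 0" for i
    have mon: "mon_eval a m = v m / v 0" if "m \<in> S" for m
    proof -
      have "mon_degree m \<le> 1" using that by (simp add: S_def)
      then consider "m = 0" | i where "m = single i 1" using mon_degree_le_1 by blast
      then show ?thesis by cases (simp_all add: v0 a_def)
    qed
    have zero: "eval_mpoly (\<lambda>x. x) a g = 0" if g: "g \<in> J" for g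
    proof -
      have "mkeys g \<subseteq> S" using supp[OF g] by (auto simp: in_keys_iff)
      then have "eval_mpoly (\<lambda>x. x) a g = (\<Sum>m\<in>S. lookup g m * mon_eval a m)"
        unfolding eval_mpoly_def using S(1) by (subst additive_ext_superset[of S]) auto
      also have "\<dots> = (\<Sum>m\<in>S. lookup g m * v m) / v 0"
        by (simp add: mon sum_divide_distrib)
      also have "(\<Sum>m\<in>S. lookup g m * v m) = coeff (\<Sum>m\<in>S. [:lookup g m:] * w m) 0"
        by (simp add: coeff_sum w mult.commute)
      also have "\<dots> = 0" using orth(3) g by simp
      finally show ?thesis by simp
    qed
    note hom = is_hom_eval_mpoly[OF is_hom_id, of a]
    have "eval_mpoly (\<lambda>x. x) a (Var x * q - 1) = 0"
      using zero unfolding J_def by (intro eval_genideal[OF is_hom_id Gc q(2)[unfolded I]]) blast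
    moreover have "eval_mpoly (\<lambda>x. x) a (Var x) = 0" by (rule zero) (simp add: J_def)
    ultimately have False by (simp add: is_hom_diff[OF hom] is_homD[OF hom])
    then show ?thesis ..
  qed
qed

section \<open>Normal forms modulo the ideal and the criterion for maximality\<close>

section \<open>Reduction modulo univariate elements\<close>

text \<open>Multiplying \<open>h\<close> by the inverse of its leading coefficient and a power of
  \<open>x\<close> makes it monic of degree exactly \<open>e\<close>, so that all variables share
  the same \<open>e\<close>.\<close>

lemma univariate_power_reduction:
  fixes I :: "'k::field mpoly set"
  assumes I: "ideal I (mpoly_ring n)" "I \<noteq> carrier (mpoly_ring n)" and x: "x \<in> {1..n}"
    and h: "h \<noteq> 0" "degree h \<le> e" "poly_eval Const (Var x) h \<in> I"
  shows "\<exists>r. degree r < e \<and> Var x ^ e - poly_eval Const (Var x) r \<in> I"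
proof -
  have pe: "is_hom (poly_eval Const (Var x) :: 'k poly \<Rightarrow> 'k mpoly)"
    by (rule is_hom_poly_eval[OF is_hom_Const])
  define s where "s = monom (inverse (lead_coeff h)) (e - degree h)"
  have deg_s: "degree s = e - degree h" using h(1) by (simp add: s_def degree_monom_eq)
  have car: "poly_eval Const (Var x) p \<in> carrier (mpoly_ring n)" for p :: "'k poly"
    using poly_eval_bounded[OF x order_refl, of p] unfolding bounded_polys_iff by blast
  have hs: "poly_eval Const (Var x) (s * h) \<in> I"
    unfolding is_homD(3)[OF pe] by (rule ideal_mpolyD(4)[OF I(1) h(3) car])
  \<comment> \<open>For \<open>e = 0\<close> the ideal would contain a nonzero constant and not be
    proper.\<close>
  have "e \<noteq> 0"
  proof
    assume "e = 0"
    then obtain a where a: "h = [:a:]" "a \<noteq> 0" using h(1,2) by (metis degree_eq_zeroE le_zero_eq pCons_0_0)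
    then have "s * h = 1" using \<open>e = 0\<close> by (simp add: s_def monom_0)
    then have "1 \<in> I" using hs is_homD(1)[OF pe] by simp
    then show False using ideal.one_imp_carrier[OF I(1)] I(2) by simp
  qed
  define r where "r = monom 1 e - s * h"
  have "s \<noteq> 0" using h(1) by (simp add: s_def)
  then have deg: "degree (s * h) = e" using h deg_s by (simp add: degree_mult_eq)
  have "lead_coeff (s * h) = 1" using h(1) by (simp add: lead_coeff_mult s_def degree_monom_eq)
  then have "coeff (s * h) e = 1" unfolding deg .
  then have "coeff r i = 0" if "i \<ge> e" for i
    using that deg coeff_eq_0[of "s * h" i] by (cases "i = e") (simp_all add: r_def)
  then have "degree r \<le> e - 1" by (intro degree_le) auto
  moreover have "Var x ^ e - poly_eval Const (Var x) r = poly_eval Const (Var x) (s * h)"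
    by (simp only: r_def is_hom_diff[OF pe] poly_eval_monom[OF is_hom_Const] single_one mult_1_left diff_diff_eq2) simp
  ultimately show ?thesis using hs \<open>e \<noteq> 0\<close> by (intro exI[of _ r]) simp
qed

definition reduced_polys :: "nat \<Rightarrow> nat \<Rightarrow> 'k::field mpoly set" where
  "reduced_polys n e = {p. \<forall>m\<in>mkeys p. mkeys m \<subseteq> {1..n} \<and> (\<forall>i. lookup m i < e)}"

lemma reduced_polys_0 [simp]: "0 \<in> reduced_polys n e"
  by (simp add: reduced_polys_def)

lemma reduced_polys_add:
  "p \<in> reduced_polys n e \<Longrightarrow> q \<in> reduced_polys n e \<Longrightarrow> p + q \<in> reduced_polys n e"
  using Poly_Mapping.keys_add[of p q] unfolding reduced_polys_def by blast

lemma reduced_polys_sum: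
  "(\<And>i. i \<in> A \<Longrightarrow> f i \<in> reduced_polys n e) \<Longrightarrow> (\<Sum>i\<in>A. f i) \<in> reduced_polys n e"
  by (induction A rule: infinite_finite_induct) (simp_all add: reduced_polys_add)

lemma reduced_polys_bounded:
  assumes "p \<in> reduced_polys n e"
  shows "p \<in> bounded_polys {1..n} (n * (e - 1))"
  unfolding bounded_polys_def
proof (intro CollectI ballI conjI)
  fix m assume m: "m \<in> mkeys p"
  then show V: "mkeys m \<subseteq> {1..n}" using assms unfolding reduced_polys_def by blast
  have lt: "lookup m i < e" for i using assms m unfolding reduced_polys_def by blast
  have "lookup m i \<le> e - 1" for i using lt[of i] by simp
  then have "(\<Sum>i\<in>{1..n}. lookup m i) \<le> (\<Sum>i\<in>{1..n}. e - 1)" by (intro sum_mono)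
  then show "mon_degree m \<le> n * (e - 1)" using mon_degree_superset[OF _ V] by simp
qed

text \<open>Only the exponent of \<open>x\<close> grows, and by 1. If it reaches \<open>e\<close>,
  the power \<open>x^e\<close> is replaced by \<open>r\<close>, which restores an exponent below
  \<open>e\<close> and leaves the other exponents alone.\<close>

lemma Var_mult_reduced:
  fixes I :: "'k::field mpoly set"
  assumes I: "ideal I (mpoly_ring n)" and x: "x \<in> {1..n}"
    and r: "degree r < e" "Var x ^ e - poly_eval Const (Var x) r \<in> I"
    and p: "p \<in> reduced_polys n e"
  shows "\<exists>p'\<in>reduced_polys n e. Var x * p - p' \<in> I"
proof (induction p rule: poly_mapping_single_induct)
  case zero
  show ?case
    by (intro bexI[of _ 0]) (simp_all add: ideal_mpolyD(2)[OF I])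
next
  case (add q q')
  then obtain s s' where "s \<in> reduced_polys n e" "Var x * q - s \<in> I"
      "s' \<in> reduced_polys n e" "Var x * q' - s' \<in> I" by blast
  moreover have "Var x * (q + q') - (s + s') = (Var x * q - s) + (Var x * q' - s')"
    by (simp add: algebra_simps)
  ultimately show ?case using reduced_polys_add ideal_mpolyD(3)[OF I] by metis
next
  case (single m)
  let ?c = "lookup p m"
  have m: "mkeys m \<subseteq> {1..n}" "lookup m i < e" for i
    using p single.hyps unfolding reduced_polys_def by blast+
  let ?m = "m - single x (lookup m x)"
  have red: "single (?m + single x l) c \<in> reduced_polys n e" if "l < e" for l and c :: 'k
  proof -
    have "mkeys (?m + single x l) \<subseteq> {1..n}"
    proof -
      have "mkeys ?m \<subseteq> {1..n}" unfolding keys_mon_split using m(1) by blast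
      moreover have "mkeys (single x l) \<subseteq> {1..n}" using x by simp
      ultimately show ?thesis using Poly_Mapping.keys_add[of ?m "single x l"] by (meson Un_least order_trans)
    qed
    moreover have "lookup (?m + single x l) i < e" for i
      using m(2)[of i] that by (simp add: lookup_add lookup_minus lookup_single when_def)
    ultimately show ?thesis by (simp add: reduced_polys_def)
  qed
  have Vm: "Var x * single m ?c = single (?m + single x (Suc (lookup m x))) ?c"
  proof -
    have "single x 1 + m = ?m + single x (Suc (lookup m x))"
      by (rule poly_mapping_eqI) (simp add: lookup_add lookup_minus lookup_single when_def)
    then show ?thesis by (simp add: Var_def mult_single)
  qed
  show ?case
  proof (cases "Suc (lookup m x) < e")
    case True
    then show ?thesis
      using red[OF True] Vm by (intro bexI[of _ "Var x * single m ?c"]) (simp_all add: ideal_mpolyD(2)[OF I])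
  next
    case False
    then have e: "Suc (lookup m x) = e" using m(2)[of x] by linarith
    let ?p = "single ?m ?c * poly_eval Const (Var x) r"
    have "single ?m ?c * Var x ^ e = Var x * single m ?c"
      unfolding Vm e by (simp add: Var_power mult_single)
    then have "Var x * single m ?c - ?p = single ?m ?c * (Var x ^ e - poly_eval Const (Var x) r)"
      by (simp only: right_diff_distrib)
    moreover have "single ?m ?c \<in> carrier (mpoly_ring n)"
      using m(1) keys_mon_split[of m x] by (auto simp: mem_carrier_mpoly_ring)
    ultimately have "Var x * single m ?c - ?p \<in> I" using ideal_mpolyD(4)[OF I r(2)] by simp
    moreover have "?p \<in> reduced_polys n e"
    proof -
      have "poly_eval Const (Var x) r = (\<Sum>l\<le>degree r. poly_eval Const (Var x) (monom (coeff r l) l))"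
        by (subst poly_as_sum_of_monoms[of r, symmetric])
           (rule is_hom_sum[OF is_hom_poly_eval[OF is_hom_Const]])
      then have "?p = (\<Sum>l\<le>degree r. single (?m + single x l) (?c * coeff r l))"
        by (simp add: sum_distrib_left poly_eval_monom is_hom_Const Var_power mult_single)
      also have "\<dots> \<in> reduced_polys n e" using r(1) by (intro reduced_polys_sum red) simp
      finally show ?thesis .
    qed
    ultimately show ?thesis by blast
  qed
qed

text \<open>A monomial is built up one variable at a time, reducing after each multiplication by
  \<open>Var_mult_reduced\<close>; additivity does the rest.\<close>

lemma reduction_mod_ideal:
  fixes I :: "'k::field mpoly set"
  assumes I: "ideal I (mpoly_ring n)" and "e > 0"
    and r: "\<And>x. x \<in> {1..n} \<Longrightarrow> \<exists>r. degree r < e \<and> Var x ^ e - poly_eval Const (Var x) r \<in> I"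
    and p: "p \<in> carrier (mpoly_ring n)"
  shows "\<exists>p'\<in>reduced_polys n e. p - p' \<in> I"
proof -
  have mon: "\<exists>p'\<in>reduced_polys n e. single m c - p' \<in> I"
    if "mkeys m \<subseteq> {1..n}" for m :: "nat \<Rightarrow>\<^sub>0 nat" and c :: 'k
    using that
  proof (induction "mon_degree m" arbitrary: m)
    case 0
    then have "\<forall>i\<in>mkeys m. lookup m i = 0" unfolding mon_degree_def by simp
    then have "mkeys m = {}" by (metis all_not_in_conv in_keys_iff)
    then have "m = 0" by simp
    then show ?case using \<open>e > 0\<close>
      by (intro bexI[of _ "single m c"]) (simp_all add: ideal_mpolyD(2)[OF I] reduced_polys_def)
  next
    case (Suc k)
    then have "m \<noteq> 0" by auto
    then obtain x where x: "x \<in> mkeys m" by (metis all_not_in_conv keys_eq_empty)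
    let ?m = "m - single x 1"
    have m: "m = single x 1 + ?m"
      using x by (intro poly_mapping_eqI)
        (auto simp: lookup_add lookup_minus lookup_single when_def in_keys_iff)
    have "mon_degree m = 1 + mon_degree ?m" by (subst m) (simp only: mon_degree_add mon_degree_single)
    moreover have "mkeys ?m \<subseteq> mkeys m"
      by (auto simp: in_keys_iff lookup_minus)
    ultimately obtain p' where p': "p' \<in> reduced_polys n e" "single ?m c - p' \<in> I"
      using Suc.hyps(1)[of ?m] Suc.hyps(2) Suc.prems by auto
    have xV: "x \<in> {1..n}" using x Suc.prems by blast
    obtain s where s: "degree s < e" "Var x ^ e - poly_eval Const (Var x) s \<in> I"
      using r[OF xV] by blast
    obtain p'' where p'': "p'' \<in> reduced_polys n e" "Var x * p' - p'' \<in> I"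
      using Var_mult_reduced[OF I xV s p'(1)] by blast
    have "(Var x :: 'k mpoly) \<in> bounded_polys {1..n} 1" by (rule Var_bounded[OF xV])
    then have "(Var x :: 'k mpoly) \<in> carrier (mpoly_ring n)" unfolding bounded_polys_iff by blast
    then have "Var x * (single ?m c - p') + (Var x * p' - p'') \<in> I"
      using p'(2) p''(2) ideal_mpolyD(3,4)[OF I] by blast
    moreover have "Var x * single ?m c = single m c"
      using m by (simp add: Var_def mult_single)
    ultimately have "single m c - p'' \<in> I" by (simp add: right_diff_distrib)
    then show ?case using p''(1) by blast
  qed
  have "p \<in> bounded_polys {1..n} (total_degree p)" using p bounded_polys_iff by blast
  then show ?thesis
  proof (induction p rule: bounded_polys_induct)
    case zero
    show ?case
      by (intro bexI[of _ 0]) (simp_all add: ideal_mpolyD(2)[OF I] reduced_polys_def)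
  next
    case (single m c)
    then show ?case using mon by blast
  next
    case (add q q')
    then obtain s s' where "s \<in> reduced_polys n e" "q - s \<in> I"
        "s' \<in> reduced_polys n e" "q' - s' \<in> I" by blast
    moreover have "(q + q') - (s + s') = (q - s) + (q' - s')" by simp
    ultimately show ?case using reduced_polys_add ideal_mpolyD(3)[OF I] by metis
  qed
qed

text \<open>An element of \<open>J\<close> outside \<open>I\<close> has a reduced representative of
  degree at most \<open>n * (e - 1)\<close>, still outside \<open>I\<close>. Maximality up to
  \<open>b\<close> inverts it, which puts 1 into \<open>J\<close>.\<close>

lemma maximalideal_of_univariate:
  fixes I :: "'k::field mpoly set"
  assumes I: "ideal I (mpoly_ring n)" "I \<noteq> carrier (mpoly_ring n)"
    and max: "maximal_up_to n b I" and "n \<ge> 1" and b: "n * (e - 1) \<le> b"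
    and h: "\<And>x. x \<in> {1..n} \<Longrightarrow> \<exists>h. h \<noteq> 0 \<and> degree h \<le> e \<and> poly_eval Const (Var x) h \<in> I"
  shows "maximalideal I (mpoly_ring n)"
proof (rule maximalidealI[OF I(1)])
  show "carrier (mpoly_ring n) \<noteq> I" using I(2) by blast
  have r: "\<exists>r. degree r < e \<and> Var x ^ e - poly_eval Const (Var x) r \<in> I" if "x \<in> {1..n}" for x
    using h[OF that] univariate_power_reduction[OF I that] by blast
  have "e > 0" using r[of 1] \<open>n \<ge> 1\<close> by force
  fix J assume J: "ideal J (mpoly_ring n)" "I \<subseteq> J" "J \<subseteq> carrier (mpoly_ring n)"
  show "J = I \<or> J = carrier (mpoly_ring n)"
  proof (cases "J \<subseteq> I")
    case False
    then obtain p where p: "p \<in> J" "p \<notin> I" by blast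
    then have pc: "p \<in> carrier (mpoly_ring n)" using J(3) by blast
    obtain p' where p': "p' \<in> reduced_polys n e" "p - p' \<in> I"
      using reduction_mod_ideal[OF I(1) \<open>e > 0\<close> r pc] by blast
    have "p' \<notin> I" using p(2) p'(2) ideal_mpolyD(3)[OF I(1), of "p - p'" p'] by auto
    moreover have "p' \<in> bounded_polys {1..n} b"
      using bounded_polys_mono[OF reduced_polys_bounded[OF p'(1)] _ b] by blast
    ultimately obtain q where q: "q \<in> carrier (mpoly_ring n)" "p' * q - 1 \<in> I"
      using max unfolding maximal_up_to_def bounded_polys_iff by blast
    have "q * p \<in> J" "p' * q - 1 \<in> J" "q * (p - p') \<in> J"
      using ideal_mpolyD(4)[OF J(1)] p(1) p'(2) q J(2) by auto
    then have "q * p - q * (p - p') - (p' * q - 1) \<in> J" using ideal_mpolyD(6)[OF J(1)] by blast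
    then have "1 \<in> J" by (simp add: algebra_simps)
    then show ?thesis using ideal.one_imp_carrier[OF J(1)] by simp
  qed (use J(2) in blast)
qed

section \<open>Numerical estimates\<close>

section \<open>The explicit bound\<close>

text \<open>The quantity \<open>Q m = cert_degree d m + d + 1\<close> satisfies
  \<open>Q (m + 1) = Q m + d * Q m ^ (m + 1)\<close>, at most \<open>2 * d * Q m ^ (m + 1)\<close>.
  The exponents close up because \<open>(m + 2)! = (m + 1)! * (m + 1) + (m + 1)!\<close>.\<close>

lemma cert_degree_le:
  assumes "d \<ge> 2"
  shows "cert_degree d m + d + 1 \<le> (2 * d) ^ fact (m + 1)"
proof (induction m)
  case (Suc m)
  let ?Q = "cert_degree d m + d + 1" and ?t = "2 * d"
  have "cert_degree d (Suc m) + d + 1 = ?Q + d * ?Q ^ Suc m" by (simp add: algebra_simps)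
  also have "\<dots> \<le> ?Q ^ Suc m + d * ?Q ^ Suc m"
    using self_le_power[of ?Q "Suc m"] by simp
  also have "\<dots> \<le> ?t * ?Q ^ Suc m" using assms by simp
  also have "\<dots> \<le> ?t * (?t ^ fact (m + 1)) ^ Suc m"
    by (intro mult_left_mono power_mono Suc.IH) simp_all
  also have "\<dots> = ?t ^ (1 + fact (m + 1) * Suc m)"
    by (simp only: power_add power_one_right power_mult)
  also have "\<dots> \<le> ?t ^ fact (Suc m + 1)"
  proof (rule power_increasing)
    have "(1 :: nat) \<le> fact (m + 1)" by (rule fact_ge_1)
    then show "1 + fact (m + 1) * Suc m \<le> (fact (Suc m + 1) :: nat)" by (simp add: algebra_simps)
  qed (use assms in simp)
  finally show ?case .
qed (use assms in simp)

text \<open>The two demands on the bound: it must admit the polynomials \<open>1 + x w\<close> of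
  \<open>univariate_mem\<close>, and the reduced polynomials with exponents below
  \<open>R * d\<close>.\<close>

lemma max_bound_ge:
  assumes n: "n \<ge> 1" and d: "d \<ge> 2" and R: "R = (cert_degree d (n - 1) + d + 1) ^ (n - 1)"
  shows "(R - 1) * d + 1 \<le> max_bound n d" "n * (R * d - 1) \<le> max_bound n d"
proof -
  have "R \<ge> 1" unfolding R by simp
  then have le: "(R - 1) * d + 1 \<le> R * d" using d by (cases R) auto
  consider "n = 1" | "n = 2" | "n \<ge> 3" using n by linarith
  then have "(R - 1) * d + 1 \<le> max_bound n d \<and> n * (R * d - 1) \<le> max_bound n d"
  proof cases
    case 1
    \<comment> \<open>The exponent \<open>n - 1\<close> is 0, so \<open>R = 1\<close>.\<close>
    then show ?thesis using d R by (simp add: max_bound_def)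
  next
    case 2
    have "cert_degree d 1 = d * (d + 1)" by simp
    then have "R = (d + 1) * (d + 1)" using 2 R by (simp add: algebra_simps)
    moreover have "(d + 1) * (d + 1) \<le> 2 * d * (d * d)"
    proof -
      have "d + 1 \<le> 2 * d" "d + 1 \<le> d * d" using d by (simp, cases d, auto)
      then show ?thesis by (rule mult_mono) simp_all
    qed
    ultimately have "R * d \<le> 2 * d ^ 4" using mult_right_mono[of R "2 * d * (d * d)" d]
      by (simp add: eval_nat_numeral algebra_simps)
    then show ?thesis using 2 d le by (simp add: max_bound_def)
  next
    case 3
    let ?t = "2 * d" and ?e = "(n - 1) * fact n"
    have t: "1 \<le> ?t" using d by simp
    have "R \<le> (?t ^ fact n) ^ (n - 1)"
      unfolding R using cert_degree_le[OF d, of "n - 1"] n by (intro power_mono) simp_all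
    also have "\<dots> = ?t ^ ?e" by (simp only: power_mult[symmetric] mult.commute)
    finally have "R \<le> ?t ^ ?e" .
    then have "R * d \<le> ?t ^ ?e * ?t" by (rule mult_mono) simp_all
    moreover have "n \<le> ?t ^ n"
      by (rule order_trans[OF less_imp_le[OF less_exp]]) (use d in \<open>intro power_mono; simp\<close>)
    ultimately have "n * (R * d) \<le> ?t ^ n * (?t ^ ?e * ?t)"
      by (intro mult_mono[of n _ "R * d"]) simp_all
    also have "\<dots> = ?t ^ (n + ?e + 1)" by (simp only: power_add power_one_right mult_ac)
    also have "\<dots> \<le> ?t ^ (?e * 2 ^ ((n - 2) * n))"
    proof (rule power_increasing[OF _ t])
      have "n \<le> fact n" by (rule fact_ge_self)
      also have "\<dots> \<le> ?e" using 3 by simp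
      finally have "n \<le> ?e" .
      \<comment> \<open>The factor \<open>2 ^ ((n - 2) * n)\<close> in the exponent is at least 4,
        which leaves room for the extra factors \<open>n\<close> and \<open>d\<close>.\<close>
      moreover have "(2 :: nat) ^ 2 \<le> 2 ^ ((n - 2) * n)"
      proof (rule power_increasing)
        have "1 * 2 \<le> (n - 2) * n" using 3 by (intro mult_mono) auto
        then show "2 \<le> (n - 2) * n" by simp
      qed simp
      then have "?e * 4 \<le> ?e * 2 ^ ((n - 2) * n)" by (intro mult_left_mono) simp_all
      ultimately show "n + ?e + 1 \<le> ?e * 2 ^ ((n - 2) * n)" using 3 by linarith
    qed
    also have "\<dots> = max_bound n d" using 3 d by (simp add: max_bound_def)
    finally have *: "n * (R * d) \<le> max_bound n d" .
    moreover have "R * d \<le> n * (R * d)" using n by simp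
    moreover have "n * (R * d - 1) \<le> n * (R * d)" by (rule mult_left_mono) simp_all
    ultimately show ?thesis using le by linarith
  qed
  then show "(R - 1) * d + 1 \<le> max_bound n d" "n * (R * d - 1) \<le> max_bound n d" by simp_all
qed

theorem theorem5p4:
  fixes n d :: nat and I G :: "'k::field mpoly set"
  assumes "n \<ge> 1" and "d \<ge> 1"
    and "G \<subseteq> carrier (mpoly_ring n)"
    and "\<forall>g\<in>G. total_degree g \<le> d"
    and "I = genideal (mpoly_ring n) G"
    and "I \<noteq> carrier (mpoly_ring n)"
    and "maximal_up_to n (max_bound n d) I"
  shows "maximalideal I (mpoly_ring n)"
proof -
  have G: "G \<subseteq> bounded_polys {1..n} d" using assms(3,4) bounded_polys_iff by blast
  have ideal: "ideal I (mpoly_ring n)"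
    unfolding assms(5) by (rule ring.genideal_ideal[OF cring.axioms(1)[OF cring_mpoly_ring] assms(3)])
  show ?thesis
  proof (cases "d = 1")
    case True
    then have max: "maximal_up_to n 1 I" using assms(7) by (simp add: max_bound_def)
    have G1: "G \<subseteq> bounded_polys {1..n} 1" using G True by simp
    \<comment> \<open>Here \<open>e = 1\<close>, so the reduced polynomials are constants.\<close>
    have b: "n * (1 - 1) \<le> 1" by simp
    show ?thesis
      by (rule maximalideal_of_univariate[OF ideal assms(6) max assms(1) b])
         (rule linear_univariate_mem[OF G1 assms(5) max])
  next
    case False
    then have d: "d \<ge> 2" using assms(2) by simp
    note b = max_bound_ge[OF assms(1) d refl]
    show ?thesis
      by (rule maximalideal_of_univariate[OF ideal assms(6,7,1) b(2)])
         (rule univariate_mem[OF G assms(5,7) _ assms(2) refl b(1)])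
  qed
qed

end
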